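(* Let $n\geq 5$ and let $f\in F(n)$ have no fixed point. Then there exists $h\in F(n)$ with $h\sim f$ such that $\mathcal{A}(h)$ has an attractor $A$ of size at most $4$ and $\mathcal{A}(h)$ has an almost decreasing path from every configuration to $A$.
   Context: $F(n)$ is the set of all functions $f:\{0,1\}^n\to\{0,1\}^n$, written $f=(f_1,\dots,f_n)$. $e_i$ is the configuration with a $1$ exactly in component $i$; addition is componentwise modulo $2$. The asynchronous graph $\mathcal{A}(f)$ is the digraph on $\{0,1\}^n$ with an arc from $x$ to $x+e_i$ whenever $f_i(x)\neq x_i$. An attractor is an inclusion-minimal non-empty set $X\subseteq\{0,1\}^n$ with no arc from $X$ to its complement. $\leq$ is the componentwise order; an arc $x\to y$ is increasing if $x<y$ and decreasing otherwise; a path is almost decreasing if all its arcs except possibly one are decreasing. $\mathcal{S}(f)$ has an arc $x\to f(x)$; $f\sim h$ means $\mathcal{S}(f)$ and $\mathcal{S}(h)$ are isomorphic. *)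

theory Defs
  imports "Graph_Theory.Graph_Theory" "HOL-Library.Cardinality"
begin

text \<open>
  \<^verbatim>\<open>{0,1}^n\<close> is the function type \<open>'n \<Rightarrow> bool\<close> with \<open>n = CARD('n)\<close>; \<open>False\<close> is 0 and
  \<open>True\<close> is 1, so the library order on \<open>'n \<Rightarrow> bool\<close> is the componentwise order.
\<close>

type_synonym 'n conf = "'n \<Rightarrow> bool"

definition conf_add :: "'n conf \<Rightarrow> 'n conf \<Rightarrow> 'n conf" (infixl "\<oplus>\<^sub>2" 65) where
  "x \<oplus>\<^sub>2 y = (\<lambda>j. x j \<noteq> y j)"

definition unit_conf :: "'n \<Rightarrow> 'n conf" where
  "unit_conf i = (\<lambda>j. j = i)"

definition async_graph :: "('n conf \<Rightarrow> 'n conf) \<Rightarrow> 'n conf pair_pre_digraph" where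
  "async_graph f = \<lparr> pverts = UNIV, parcs = {(x, x \<oplus>\<^sub>2 unit_conf i) | x i. f x i \<noteq> x i} \<rparr>"

definition sync_graph :: "('n conf \<Rightarrow> 'n conf) \<Rightarrow> 'n conf pair_pre_digraph" where
  "sync_graph f = \<lparr> pverts = UNIV, parcs = {(x, f x) | x. True} \<rparr>"

definition isomorphic_networks :: "('n conf \<Rightarrow> 'n conf) \<Rightarrow> ('n conf \<Rightarrow> 'n conf) \<Rightarrow> bool"
    (infix "\<sim>\<^sub>S" 50) where
  "f \<sim>\<^sub>S h \<longleftrightarrow> digraph_iso (with_proj (sync_graph f)) (with_proj (sync_graph h))"

definition no_leaving_arc :: "'a pair_pre_digraph \<Rightarrow> 'a set \<Rightarrow> bool" where
  "no_leaving_arc G X \<longleftrightarrow> \<not> (\<exists>(x, y) \<in> parcs G. x \<in> X \<and> y \<notin> X)"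

definition attractor :: "'a pair_pre_digraph \<Rightarrow> 'a set \<Rightarrow> bool" where
  "attractor G A \<longleftrightarrow>
     A \<subseteq> pverts G \<and> A \<noteq> {} \<and> no_leaving_arc G A \<and>
     (\<forall>B. B \<noteq> {} \<and> B \<subseteq> A \<and> no_leaving_arc G B \<longrightarrow> B = A)"

definition increasing_arc :: "'n conf \<times> 'n conf \<Rightarrow> bool" where
  "increasing_arc a \<longleftrightarrow> fst a < snd a"

text \<open>
  Paths are given by their list of arcs and visit pairwise distinct vertices; the empty
  list is the path of length 0.
\<close>

definition almost_decreasing_path ::
    "'n conf pair_pre_digraph \<Rightarrow> 'n conf \<Rightarrow> ('n conf \<times> 'n conf) awalk \<Rightarrow> 'n conf \<Rightarrow> bool" where
  "almost_decreasing_path G x p y \<longleftrightarrow>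
     pre_digraph.apath (with_proj G) x p y \<and> length (filter increasing_arc p) \<le> 1"

end

theory Submission
  imports Defs
begin

text \<open>
  Replacing \<open>f\<close> by an isomorphic network amounts to labelling the points by subsets of the
  coordinates. A label \<open>S\<close> has a decreasing arc iff \<open>S\<close> is not contained in the label of the image.
  Hence it suffices to place a small attractor containing the empty label and to label the remaining
  points such that no image lies above its point, except for a single point \<open>E\<close> which can make one
  increasing step and then avoid coming back. Some exception is unavoidable if \<open>f\<close> is a permutation,
  since the full label is above everything.

  The attractor is an edge if \<open>f\<close> has a 2-cycle; otherwise it is a path on three vertices, whose
  centre is a point with two preimages, if \<open>f\<close> is not injective, and a path on four vertices
  if \<open>f\<close> is a permutation. In the last case a cycle of length at least 4 is needed, which exists
  because 3 does not divide \<open>2 ^ n\<close>.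
\<close>

section \<open>Periodic points\<close>

text \<open>The obstacle is the full label. Its point \<open>q\<close> has a decreasing arc because
  \<open>f q\<close> differs from \<open>q\<close>, but the label of every preimage of
  \<open>q\<close> lies below that of its image. So \<open>q\<close> should be outside the range of
  \<open>f\<close> or have a single preimage, and that preimage becomes \<open>E\<close>. A second
  constraint concerns points without prescribed label whose image has a prescribed label
  \<open>S\<close>: they must not receive a subset of \<open>S\<close>. Either all subsets of
  \<open>S\<close> are prescribed for other points, or all preimages have prescribed labels. Hence
  the extra points labelled beside the attractor. On the remaining points the label size must
  sometimes grow along \<open>f\<close>, since \<open>f\<close> may permute them. A ranking keeps
  these ascents disjoint, and each is made harmless by a coordinate \<open>p\<close> in the lower
  label and not in the upper one.\<close>

lemma funpow_mem:
  assumes "f ` R \<subseteq> R" and "x \<in> R"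
  shows "(f ^^ i) x \<in> R"
  using assms by (induction i) auto

lemma funpow_cancel_inj_on:
  assumes "inj_on f R" and "f ` R \<subseteq> R" and "x \<in> R" and "y \<in> R"
    and "(f ^^ i) x = (f ^^ i) y"
  shows "x = y"
  using assms(5)
proof (induction i)
  case (Suc i)
  have "(f ^^ i) x \<in> R" "(f ^^ i) y \<in> R"
    using assms by (auto intro: funpow_mem)
  with Suc assms(1) show ?case by (auto dest: inj_onD)
qed simp

lemma funpow_period:
  assumes "finite R" and "inj_on f R" and "f ` R \<subseteq> R" and "x \<in> R"
  obtains l where "l > 0" and "(f ^^ l) x = x" and "inj_on (\<lambda>i. (f ^^ i) x) {..<l}"
proof -
  \<comment> \<open>Injectivity cancels the common first \<open>i\<close> steps, so a repetition
    anywhere yields one at \<open>x\<close>: the orbit has no tail.\<close>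
  have shorten: "(f ^^ (j - i)) x = x" if "i < j" "(f ^^ i) x = (f ^^ j) x" for i j :: nat
  proof -
    have "(f ^^ i) ((f ^^ (j - i)) x) = (f ^^ (i + (j - i))) x"
      by (simp only: funpow_add o_apply)
    with that have "(f ^^ i) ((f ^^ (j - i)) x) = (f ^^ i) x" by simp
    then show ?thesis
      using funpow_cancel_inj_on[OF assms(2,3)] funpow_mem[OF assms(3,4)] assms(4) by blast
  qed
  have "range (\<lambda>i. (f ^^ i) x) \<subseteq> R" using funpow_mem[OF assms(3,4)] by auto
  then have "\<not> inj (\<lambda>i. (f ^^ i) x)"
    using assms(1) finite_imageD finite_subset infinite_UNIV_nat by blast
  then obtain i j :: nat where "i < j" "(f ^^ i) x = (f ^^ j) x"
    unfolding inj_def by (metis nat_neq_iff)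
  then have ex: "\<exists>l>0. (f ^^ l) x = x" using shorten zero_less_diff by blast
  define l where "l = (LEAST l. l > 0 \<and> (f ^^ l) x = x)"
  have l: "l > 0" "(f ^^ l) x = x" using LeastI_ex[OF ex] unfolding l_def by auto
  have min: "l \<le> k" if "k > 0" "(f ^^ k) x = x" for k
    unfolding l_def using that by (intro Least_le) auto
  have neq: "(f ^^ i) x \<noteq> (f ^^ j) x" if "i < j" "j < l" for i j
    using shorten[of i j] min[of "j - i"] that by force
  have "inj_on (\<lambda>i. (f ^^ i) x) {..<l}"
    by (rule linorder_inj_onI') (use neq in auto)
  with l show ?thesis using that by blast
qed

lemma periodic_funpow:
  assumes "(f ^^ l) x = x"
  shows "(f ^^ l) ((f ^^ m) x) = (f ^^ m) x"
  using assms by (metis add.commute comp_apply funpow_add)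

text \<open>The orbit of a point outside the range starts off every cycle. Where it first enters
  one, the entry point has a preimage on the tail and another on the cycle.\<close>

lemma periodic_point_with_nonperiodic_preimage:
  fixes f :: "'a::finite \<Rightarrow> 'a"
  assumes "\<not> surj f"
  obtains v u\<^sub>1 u\<^sub>2 where "f u\<^sub>1 = v" and "f u\<^sub>2 = v"
    and "\<exists>l>0. (f ^^ l) u\<^sub>1 = u\<^sub>1" and "\<not> (\<exists>l>0. (f ^^ l) u\<^sub>2 = u\<^sub>2)"
proof -
  let ?per = "\<lambda>x. \<exists>l>0. (f ^^ l) x = x"
  obtain x where x: "x \<notin> range f" using assms by blast
  have "\<not> ?per x"
  proof
    assume "?per x"
    then obtain l where "l > 0" "(f ^^ l) x = x" by blast
    then have "x = f ((f ^^ (l - 1)) x)" by (metis Suc_diff_1 comp_apply funpow.simps(2))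
    then show False using x by (metis rangeI)
  qed
  have "\<exists>m. ?per ((f ^^ m) x)"
  proof -
    have "\<not> inj (\<lambda>m. (f ^^ m) x)"
      using finite_imageD[of "\<lambda>m. (f ^^ m) x" UNIV] infinite_UNIV_nat by auto
    then obtain m n :: nat where mn: "m < n" "(f ^^ m) x = (f ^^ n) x"
      unfolding inj_def by (metis nat_neq_iff)
    then have "(f ^^ (n - m)) ((f ^^ m) x) = (f ^^ m) x"
      by (metis add_diff_inverse_nat add.commute comp_apply funpow_add less_imp_not_less)
    then show ?thesis using mn(1) zero_less_diff by blast
  qed
  define m where "m = (LEAST m. ?per ((f ^^ m) x))"
  have m: "?per ((f ^^ m) x)"
    unfolding m_def by (rule LeastI_ex) fact
  have min: "\<not> ?per ((f ^^ m') x)" if "m' < m" for m'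
    using that unfolding m_def by (rule not_less_Least)
  have "m > 0" using m \<open>\<not> ?per x\<close> by (cases m) auto
  define u\<^sub>2 where "u\<^sub>2 = (f ^^ (m - 1)) x"
  have u2: "\<not> ?per u\<^sub>2" "f u\<^sub>2 = (f ^^ m) x"
    using min[of "m - 1"] \<open>m > 0\<close> unfolding u\<^sub>2_def
    by (simp, metis Suc_diff_1 comp_apply funpow.simps(2))
  obtain l where l: "l > 0" "(f ^^ l) ((f ^^ m) x) = (f ^^ m) x" using m by blast
  define u\<^sub>1 where "u\<^sub>1 = (f ^^ (l - 1)) ((f ^^ m) x)"
  have u1: "f u\<^sub>1 = (f ^^ m) x" using l unfolding u\<^sub>1_def by (metis Suc_diff_1 comp_apply funpow.simps(2))
  have "?per u\<^sub>1" using periodic_funpow[OF l(2)] l(1) unfolding u\<^sub>1_def by blast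
  then show ?thesis using that u1 u2 by blast
qed

section \<open>Labelling without ascents\<close>

text \<open>
  A point without preimage in \<open>R\<close> is ranked last; if there is none, \<open>f\<close> permutes \<open>R\<close> and a
  whole cycle is ranked last, against the direction of \<open>f\<close>, so that only one of its arcs ascends.
\<close>

lemma ranking_with_disjoint_ascents:
  assumes "finite R"
  shows "\<exists>r. bij_betw r R {..<card R} \<and>
    (\<forall>x\<in>R. \<forall>y\<in>R. f x \<in> R \<and> f y \<in> R \<and> r x < r (f x) \<and> r y < r (f y) \<and> x \<noteq> y
       \<longrightarrow> r (f x) < r y \<or> r (f y) < r x)"
  using assms
proof (induction R rule: finite_psubset_induct)
  case (psubset R)
  show ?case
  proof (cases "R \<subseteq> f ` R")
    case False
    then obtain x where x: "x \<in> R" "x \<notin> f ` R" by blast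
    let ?S = "R - {x}"
    obtain r where r: "bij_betw r ?S {..<card ?S}"
      and dis: "\<And>y z. \<lbrakk>y \<in> ?S; z \<in> ?S; f y \<in> ?S; f z \<in> ?S; r y < r (f y); r z < r (f z); y \<noteq> z\<rbrakk>
         \<Longrightarrow> r (f y) < r z \<or> r (f z) < r y"
      using psubset.IH[of ?S] x by blast
    define r' where "r' = r(x := card ?S)"
    have cR: "card R = Suc (card ?S)" using x psubset.hyps by (metis card.remove)
    have "bij_betw r' (?S \<union> {x}) ({..<card ?S} \<union> {card ?S})"
    proof (rule bij_betw_combine)
      show "bij_betw r' ?S {..<card ?S}"
        using r by (rule bij_betw_cong[THEN iffD1, rotated]) (auto simp: r'_def)
    qed (auto simp: r'_def)
    moreover have "?S \<union> {x} = R" "{..<card ?S} \<union> {card ?S} = {..<card R}"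
      using x cR by auto
    ultimately have bij: "bij_betw r' R {..<card R}" by simp
    have lt: "r y < card ?S" if "y \<in> ?S" for y using r that by (auto simp: bij_betw_def)
    \<comment> \<open>No arc inside \<open>R\<close> enters \<open>x\<close>, and the arc leaving
      \<open>x\<close> starts at the top rank, so ascents for \<open>r'\<close> are ascents for
      \<open>r\<close>.\<close>
    have x': "y \<noteq> x" "f y \<noteq> x" if "y \<in> R" "f y \<in> R" "r' y < r' (f y)" for y
    proof -
      show "f y \<noteq> x" using x that by auto
      then show "y \<noteq> x" using that lt[of "f y"] by (auto simp: r'_def)
    qed
    show ?thesis
    proof (intro exI[of _ r'] conjI bij ballI impI, elim conjE)
      fix y z assume *: "y \<in> R" "z \<in> R" "f y \<in> R" "f z \<in> R" "r' y < r' (f y)"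
        "r' z < r' (f z)" "y \<noteq> z"
      have ne: "y \<noteq> x" "f y \<noteq> x" "z \<noteq> x" "f z \<noteq> x"
        using x'[of y] x'[of z] * by auto
      have "r (f y) < r z \<or> r (f z) < r y"
        by (rule dis) (use * ne in \<open>simp_all add: r'_def\<close>)
      then show "r' (f y) < r' z \<or> r' (f z) < r' y"
        using ne by (simp add: r'_def)
    qed
  next
    case True
    show ?thesis
    proof (cases "R = {}")
      case True
      then show ?thesis by (auto simp: bij_betw_def)
    next
      case False
      then obtain x where x: "x \<in> R" by blast
      have fR: "f ` R = R" using True psubset.hyps
        by (metis card_image_le card_seteq finite_imageI)
      have inj: "inj_on f R" using True psubset.hyps finite_surj_inj by blast
      obtain l where l: "l > 0" "(f ^^ l) x = x" "inj_on (\<lambda>i. (f ^^ i) x) {..<l}"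
        using funpow_period[OF psubset.hyps(1) inj _ x] fR by blast
      define C where "C = (\<lambda>i. (f ^^ i) x) ` {..<l}"
      define idx where "idx = inv_into {..<l} (\<lambda>i. (f ^^ i) x)"
      have idx: "idx ((f ^^ i) x) = i" if "i < l" for i
        unfolding idx_def using inv_into_f_f[OF l(3), of i] that by simp
      have CR: "C \<subseteq> R" unfolding C_def using funpow_mem[OF _ x] fR by auto
      have cC: "card C = l" unfolding C_def using l(3) by (simp add: card_image)
      have Cne: "C \<noteq> {}" using l(1) unfolding C_def by auto
      have fC: "f ` C = C"
      proof -
        have "f ` C \<subseteq> C"
        proof clarify
          fix y assume "y \<in> C"
          then obtain i where i: "i < l" "y = (f ^^ i) x" unfolding C_def by auto
          show "f y \<in> C"
          proof (cases "Suc i < l")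
            case True
            then show ?thesis using i unfolding C_def by (auto intro!: image_eqI[of _ _ "Suc i"])
          next
            case False
            then have "Suc i = l" using i by simp
            then have "f y = (f ^^ 0) x" using i l(2) by auto
            then show ?thesis using l(1) unfolding C_def by blast
          qed
        qed
        then show ?thesis
          using endo_inj_surj[of C f] inj CR psubset.hyps
          by (meson finite_subset inj_on_subset)
      qed
      let ?S = "R - C"
      have fS: "f y \<in> ?S" if "y \<in> ?S" for y
      proof -
        have "f y \<notin> C"
        proof
          assume "f y \<in> C"
          then obtain c where "c \<in> C" "f y = f c" using fC by blast
          then show False using inj CR that by (metis DiffE inj_onD subsetD)
        qed
        then show ?thesis using that fR by auto
      qed
      obtain r where r: "bij_betw r ?S {..<card ?S}"
        and dis: "\<And>y z. \<lbrakk>y \<in> ?S; z \<in> ?S; f y \<in> ?S; f z \<in> ?S; r y < r (f y); r z < r (f z); y \<noteq> z\<rbrakk>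
           \<Longrightarrow> r (f y) < r z \<or> r (f z) < r y"
        using psubset.IH[of ?S] CR Cne by blast
      define r' where "r' y = (if y \<in> C then card R - 1 - idx y else r y)" for y
      have cR: "card R = card ?S + l"
        using cC CR psubset.hyps by (metis card_Diff_subset card_mono finite_subset le_add_diff_inverse2)
      have lt: "r y < card ?S" if "y \<in> ?S" for y using r that by (auto simp: bij_betw_def)
      have rC: "r' ((f ^^ i) x) = card R - 1 - i" if "i < l" for i
        using that idx[OF that] by (auto simp: r'_def C_def)
      have "bij_betw r' (?S \<union> C) ({..<card ?S} \<union> {card ?S..<card R})"
      proof (rule bij_betw_combine)
        show "bij_betw r' ?S {..<card ?S}"
          using r by (rule bij_betw_cong[THEN iffD1, rotated]) (auto simp: r'_def)
        have injC: "inj_on r' C"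
        proof (rule inj_onI)
          fix y z assume "y \<in> C" "z \<in> C" and eq: "r' y = r' z"
          then obtain i j where ij: "i < l" "j < l" "y = (f ^^ i) x" "z = (f ^^ j) x"
            unfolding C_def by auto
          then have "card R - 1 - i = card R - 1 - j" using eq rC[of i] rC[of j] by simp
          then have "i = j" using ij(1,2) cR by linarith
          then show "y = z" using ij by simp
        qed
        have "r' ` C \<subseteq> {card ?S..<card R}"
          using rC cR by (auto simp: C_def)
        moreover have "card (r' ` C) = card {card ?S..<card R}"
          using injC cC cR by (simp add: card_image)
        ultimately have "r' ` C = {card ?S..<card R}"
          by (simp add: card_subset_eq)
        then show "bij_betw r' C {card ?S..<card R}" using injC by (simp add: bij_betw_def)
      qed auto
      moreover have "?S \<union> C = R" "{..<card ?S} \<union> {card ?S..<card R} = {..<card R}"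
        using CR cR by auto
      ultimately have bij: "bij_betw r' R {..<card R}" by simp
      have asc: "y = (f ^^ (l - 1)) x" if "y \<in> C" "r' y < r' (f y)" for y
      proof -
        obtain i where i: "i < l" "y = (f ^^ i) x" using \<open>y \<in> C\<close> unfolding C_def by auto
        have "\<not> Suc i < l"
        proof
          assume "Suc i < l"
          then show False using that(2) i rC[of i] rC[of "Suc i"] by simp
        qed
        then have "i = l - 1" using i(1) by simp
        then show ?thesis using i by simp
      qed
      \<comment> \<open>The only possible ascent inside \<open>C\<close> runs from its lowest rank
        to its highest. As the images of all other points rank below \<open>C\<close>, it is
        disjoint from their ascents.\<close>
      have above: "r' (f y) < r' z" if "y \<in> ?S" "z \<in> C" for y z
      proof -
        obtain i where "i < l" "z = (f ^^ i) x" using \<open>z \<in> C\<close> unfolding C_def by auto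
        then have "r' z \<ge> card ?S" using rC[of i] cR by simp
        moreover have "r' (f y) < card ?S" using fS[OF that(1)] lt by (auto simp: r'_def)
        ultimately show ?thesis by simp
      qed
      show ?thesis
      proof (intro exI[of _ r'] conjI bij ballI impI, elim conjE)
        fix y z assume *: "y \<in> R" "z \<in> R" "f y \<in> R" "f z \<in> R" "r' y < r' (f y)"
          "r' z < r' (f z)" "y \<noteq> z"
        show "r' (f y) < r' z \<or> r' (f z) < r' y"
        proof (cases "y \<in> C"; cases "z \<in> C")
          assume "y \<in> C" "z \<in> C"
          then show ?thesis using asc[of y] asc[of z] * by simp
        next
          assume "y \<in> C" "z \<notin> C"
          then show ?thesis using above[of z y] * by simp
        next
          assume "y \<notin> C" "z \<in> C"
          then show ?thesis using above[of y z] * by simp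
        next
          assume "y \<notin> C" "z \<notin> C"
          moreover from this have "y \<in> ?S" "z \<in> ?S" using * by auto
          moreover from this have "f y \<in> ?S" "f z \<in> ?S" using fS by auto
          ultimately show ?thesis using dis[of y z] * by (simp add: r'_def)
        qed
      qed
    qed
  qed
qed

section \<open>Filling the levels of the cube\<close>

lemma bij_betw_sorted_by:
  fixes w :: "'a \<Rightarrow> nat"
  assumes "finite L"
  obtains s where "bij_betw s {..<card L} L" and "\<And>i j. i \<le> j \<Longrightarrow> j < card L \<Longrightarrow> w (s i) \<le> w (s j)"
proof -
  obtain ys where ys: "set ys = L" "distinct ys" using assms finite_distinct_list by blast
  define xs where "xs = sort_key w ys"
  have xs: "set xs = L" "distinct xs" "sorted (map w xs)"
    using ys unfolding xs_def by auto
  then have len: "length xs = card L" by (metis distinct_card)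
  show ?thesis
  proof
    show "bij_betw ((!) xs) {..<card L} L"
      using xs len by (intro bij_betw_nth) auto
    show "w (xs ! i) \<le> w (xs ! j)" if "i \<le> j" "j < card L" for i j
      using sorted_nth_mono[OF xs(3) that(1)] that len by simp
  qed
qed

text \<open>Injections of \<open>U\<close> and \<open>V\<close> into the two sides have disjoint
  images and leave remainders of equal size, so any bijection of the remainders completes them. It
  is applied to one level of labels, with \<open>Q\<close> meaning that the label contains
  \<open>p\<close>.\<close>

lemma permutation_with_prescribed_sides:
  assumes "finite S" and "U \<subseteq> S" and "V \<subseteq> S" and "U \<inter> V = {}"
    and "card U \<le> card {z \<in> S. Q z}" and "card V \<le> card {z \<in> S. \<not> Q z}"
  shows "\<exists>g. bij_betw g S S \<and> (\<forall>x\<in>U. Q (g x)) \<and> (\<forall>x\<in>V. \<not> Q (g x))"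
proof -
  have fin: "finite U" "finite V" using assms(1-3) by (auto intro: finite_subset)
  obtain a where a: "a ` U \<subseteq> {z \<in> S. Q z}" "inj_on a U"
    using card_le_inj[OF fin(1) _ assms(5)] assms(1) by auto
  obtain b where b: "b ` V \<subseteq> {z \<in> S. \<not> Q z}" "inj_on b V"
    using card_le_inj[OF fin(2) _ assms(6)] assms(1) by auto
  define M where "M = S - (U \<union> V)"
  define M' where "M' = S - (a ` U \<union> b ` V)"
  have "card (a ` U \<union> b ` V) = card (U \<union> V)"
    using a b assms(4) fin by (subst card_Un_disjoint) (auto simp: card_image card_Un_disjoint)
  moreover have "a ` U \<union> b ` V \<subseteq> S" "U \<union> V \<subseteq> S" using a b assms by auto
  ultimately have "card M = card M'"
    unfolding M_def M'_def using fin by (simp add: card_Diff_subset)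
  then obtain c where c: "bij_betw c M M'"
    using finite_same_card_bij assms(1) unfolding M_def M'_def by blast
  define g where "g x = (if x \<in> U then a x else if x \<in> V then b x else c x)" for x
  have "bij_betw g (U \<union> V \<union> M) (a ` U \<union> b ` V \<union> M')"
  proof (intro bij_betw_combine)
    show "bij_betw g U (a ` U)"
      using a by (auto simp: bij_betw_def g_def inj_on_def)
    show "bij_betw g V (b ` V)"
      using b assms(4) by (auto simp: bij_betw_def g_def inj_on_def)
    show "bij_betw g M M'"
      using c by (rule bij_betw_cong[THEN iffD1, rotated]) (auto simp: g_def M_def)
  qed (use a b M'_def in auto)
  moreover have "U \<union> V \<union> M = S" "a ` U \<union> b ` V \<union> M' = S"
    using a b assms unfolding M_def M'_def by auto
  ultimately have "bij_betw g S S" by simp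
  moreover have "Q (g x)" if "x \<in> U" for x using that a by (auto simp: g_def)
  moreover have "\<not> Q (g x)" if "x \<in> V" for x using that b assms(4) by (auto simp: g_def)
  ultimately show ?thesis by blast
qed

text \<open>
  Fill the free labels level by level in the order of the ranking. Only ascents between different
  levels can put \<open>f x\<close> above \<open>x\<close>; each level has at most one source and one target of such an
  ascent, and they are kept incomparable by the coordinate \<open>p\<close>.
\<close>

lemma label_remaining_points:
  fixes f :: "'a::finite \<Rightarrow> 'a" and K :: "'n::finite set set"
  assumes nofix: "\<And>x. f x \<noteq> x" and card: "card (- P) = card (- K)"
    and K0: "{} \<in> K" "UNIV \<in> K"
    and Kp: "\<And>S. S \<in> K \<Longrightarrow> p \<in> S \<Longrightarrow> CARD('n) \<le> Suc (card S)"
    and Kst: "\<And>S. s \<in> S \<Longrightarrow> t \<in> S \<Longrightarrow> p \<notin> S \<Longrightarrow> S \<notin> K"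
    and dist: "s \<noteq> p" "t \<noteq> p"
  obtains \<rho> where "bij_betw \<rho> (- P) (- K)"
    and "\<And>x. x \<notin> P \<Longrightarrow> f x \<notin> P \<Longrightarrow> \<not> \<rho> x \<subseteq> \<rho> (f x)"
proof -
  let ?R = "- P" and ?L = "- K"
  obtain r where r: "bij_betw r ?R {..<card ?R}"
    and dis: "\<And>x y. \<lbrakk>x \<in> ?R; y \<in> ?R; f x \<in> ?R; f y \<in> ?R; r x < r (f x); r y < r (f y); x \<noteq> y\<rbrakk>
       \<Longrightarrow> r (f x) < r y \<or> r (f y) < r x"
    using ranking_with_disjoint_ascents[of ?R f] by auto
  obtain \<sigma> where \<sigma>: "bij_betw \<sigma> {..<card ?L} ?L"
    and mono: "\<And>i j. i \<le> j \<Longrightarrow> j < card ?L \<Longrightarrow> card (\<sigma> i) \<le> card (\<sigma> j)"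
    using bij_betw_sorted_by[of ?L card] by auto
  define \<rho>0 where "\<rho>0 = \<sigma> \<circ> r"
  have \<rho>0: "bij_betw \<rho>0 ?R ?L"
    unfolding \<rho>0_def using r \<sigma> card by (metis bij_betw_trans)
  define W where "W x = card (\<rho>0 x)" for x
  have rlt: "r x < card ?L" if "x \<in> ?R" for x using r that card by (auto simp: bij_betw_def)
  have W_mono: "W x \<le> W y" if "x \<in> ?R" "y \<in> ?R" "r x \<le> r y" for x y
    using mono[OF that(3) rlt[OF that(2)]] by (simp add: W_def \<rho>0_def)
  have W_less: "r x < r y" if "x \<in> ?R" "y \<in> ?R" "W x < W y" for x y
    using W_mono[OF that(2,1)] that(3) by force
  \<comment> \<open>Only these arcs matter: if the size does not grow, inclusion would force equal
    labels, hence a fixed point.\<close>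
  define B where "B = {x \<in> ?R. f x \<in> ?R \<and> W x < W (f x)}"
  have B: "x \<in> ?R" "f x \<in> ?R" "W x < W (f x)" "r x < r (f x)" if "x \<in> B" for x
    using that W_less by (auto simp: B_def)
  \<comment> \<open>Sizes are monotone in the rank, so disjoint intervals of ranks become intervals
    of sizes that share at most an endpoint.\<close>
  have sep: "W (f x) \<le> W y \<or> W (f y) \<le> W x" if "x \<in> B" "y \<in> B" "x \<noteq> y" for x y
    using dis[OF B(1)[OF that(1)] B(1)[OF that(2)] B(2)[OF that(1)] B(2)[OF that(2)]
        B(4)[OF that(1)] B(4)[OF that(2)] that(3)] W_mono B that by (meson less_imp_le)
  have B_level: "x = y" if "x \<in> B" "y \<in> B" "W x = W y" for x y
    using sep[OF that(1,2)] B(3)[OF that(1)] B(3)[OF that(2)] that(3) by force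
  have T_level: "f x = f y" if "x \<in> B" "y \<in> B" "W (f x) = W (f y)" for x y
    using sep[OF that(1,2)] B(3)[OF that(1)] B(3)[OF that(2)] that(3) by force
  \<comment> \<open>A shared point would make two rank intervals meet. So the source and the target
    on a single level are different points and can be separated.\<close>
  have BT: "f x \<noteq> y" if "x \<in> B" "y \<in> B" for x y
  proof
    assume eq: "f x = y"
    then have "x \<noteq> y" using nofix by metis
    then have "r (f x) < r y \<or> r (f y) < r x"
      using dis B that by metis
    then show False using eq B(4)[OF that(1)] B(4)[OF that(2)] by force
  qed
  have L_card: "0 < card S" "card S < CARD('n)" if "S \<in> ?L" for S
  proof -
    have "S \<noteq> {}" "S \<subset> UNIV" using that K0 by auto
    then show "0 < card S" "card S < CARD('n)"
      by (auto simp: card_gt_0_iff intro: psubset_card_mono)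
  qed
  have W_range: "0 < W x" "W x < CARD('n)" if "x \<in> ?R" for x
  proof -
    have "\<rho>0 x \<in> ?L" using that bij_betw_apply[OF \<rho>0] by blast
    then show "0 < W x" "W x < CARD('n)" using L_card by (auto simp: W_def)
  qed
  define lev where "lev k = {S \<in> ?L. card S = k}" for k
  have "\<exists>g. bij_betw g (lev k) (lev k) \<and> (\<forall>x\<in>B. W x = k \<longrightarrow> p \<in> g (\<rho>0 x)) \<and>
      (\<forall>x\<in>B. W (f x) = k \<longrightarrow> p \<notin> g (\<rho>0 (f x)))" for k
  proof -
    let ?U = "\<rho>0 ` {x \<in> B. W x = k}" and ?V = "\<rho>0 ` {y. \<exists>x\<in>B. y = f x \<and> W (f x) = k}"
    have mem: "\<rho>0 x \<in> ?L" if "x \<in> ?R" for x using that bij_betw_apply[OF \<rho>0] by blast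
    have sub: "?U \<subseteq> lev k" "?V \<subseteq> lev k"
      using B mem by (auto simp: lev_def W_def)
    have inj: "inj_on \<rho>0 ?R" using \<rho>0 by (simp add: bij_betw_def)
    have disj: "?U \<inter> ?V = {}"
    proof (rule ccontr)
      assume "?U \<inter> ?V \<noteq> {}"
      then obtain x y where "x \<in> B" "y \<in> B" "\<rho>0 y = \<rho>0 (f x)" by auto
      then have "y = f x" using inj B by (meson inj_onD)
      then show False using BT \<open>x \<in> B\<close> \<open>y \<in> B\<close> by blast
    qed
    have cU: "card ?U \<le> card {S \<in> lev k. p \<in> S}"
    proof (cases "{x \<in> B. W x = k} = {}")
      case True
      then show ?thesis by (simp only: image_empty card.empty)
    next
      case False
      then obtain x where x: "x \<in> B" "W x = k" by blast
      then have U: "?U = {\<rho>0 x}" using B_level by auto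
      \<comment> \<open>The image lies on a higher level that is still below the full label. Hence
        \<open>k\<close> is at most \<open>CARD('n) - 2\<close>, and by \<open>Kp\<close> every
        label of size \<open>k\<close> containing \<open>p\<close> is free.\<close>
      have k: "1 \<le> k" "Suc k < CARD('n)"
        using x B[OF x(1)] W_range[of x] W_range[of "f x"] by auto
      obtain S where S: "{p} \<subseteq> S" "card S = k"
        using exists_subset_between[of "{p}" k UNIV] k by auto
      then have "S \<in> lev k" using Kp[of S] k by (auto simp: lev_def)
      then have "{S \<in> lev k. p \<in> S} \<noteq> {}" using S by blast
      then have "0 < card {S \<in> lev k. p \<in> S}" by (simp add: card_gt_0_iff)
      then show ?thesis unfolding U by simp
    qed
    have cV: "card ?V \<le> card {S \<in> lev k. p \<notin> S}"
    proof (cases "\<exists>x\<in>B. W (f x) = k")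
      case False
      then have "?V = {}" by blast
      then show ?thesis by (simp only: card.empty)
    next
      case True
      then obtain x where x: "x \<in> B" "W (f x) = k" by blast
      have "?V \<subseteq> {\<rho>0 (f x)}"
      proof
        fix S assume "S \<in> ?V"
        then obtain y where y: "y \<in> B" "W (f y) = k" "S = \<rho>0 (f y)" by blast
        then have "f y = f x" using T_level[of y x] x by simp
        then show "S \<in> {\<rho>0 (f x)}" using y by simp
      qed
      then have V: "card ?V \<le> 1" using card_mono[of "{\<rho>0 (f x)}" ?V] by simp
      \<comment> \<open>The source already has size at least 1, so a label of the size of its image
        has room for \<open>s\<close> and \<open>t\<close>; with these and without \<open>p\<close>
        it is free by \<open>Kst\<close>.\<close>
      have k: "2 \<le> k" "k < CARD('n)"
        using x B[OF x(1)] W_range[of x] W_range[of "f x"] by auto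
      have "card {s, t} \<le> k" using k by (simp add: card_insert_if)
      moreover have "k \<le> card (- {p})"
        using k by (simp add: Compl_eq_Diff_UNIV card_Diff_subset)
      moreover have "{s, t} \<subseteq> - {p}" using dist by simp
      ultimately obtain S where S: "{s, t} \<subseteq> S" "S \<subseteq> - {p}" "card S = k"
        using exists_subset_between[of "{s, t}" k "- {p}"] finite by blast
      then have "S \<in> lev k" using Kst[of S] by (auto simp: lev_def)
      then have "{S \<in> lev k. p \<notin> S} \<noteq> {}" using S by blast
      then have "0 < card {S \<in> lev k. p \<notin> S}" by (simp add: card_gt_0_iff)
      then show ?thesis using V by linarith
    qed
    obtain g where "bij_betw g (lev k) (lev k)"
      and gU: "\<forall>S\<in>?U. p \<in> g S" and gV: "\<forall>S\<in>?V. p \<notin> g S"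
      using permutation_with_prescribed_sides[OF finite sub disj cU cV] by (elim exE conjE)
    moreover have "p \<in> g (\<rho>0 x)" if "x \<in> B" "W x = k" for x
      by (rule bspec[OF gU], rule imageI) (use that in simp)
    moreover have "p \<notin> g (\<rho>0 (f x))" if "x \<in> B" "W (f x) = k" for x
      by (rule bspec[OF gV], rule imageI, rule CollectI, rule bexI[of _ x]) (use that in simp_all)
    ultimately show ?thesis by (intro exI[of _ g] conjI ballI impI)
  qed
  then have "\<exists>\<tau>. \<forall>k. bij_betw (\<tau> k) (lev k) (lev k) \<and>
      (\<forall>x\<in>B. W x = k \<longrightarrow> p \<in> \<tau> k (\<rho>0 x)) \<and>
      (\<forall>x\<in>B. W (f x) = k \<longrightarrow> p \<notin> \<tau> k (\<rho>0 (f x)))"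
    by (intro choice allI)
  then obtain \<tau> where \<tau>: "\<And>k. bij_betw (\<tau> k) (lev k) (lev k)"
    and \<tau>B: "\<And>x. x \<in> B \<Longrightarrow> p \<in> \<tau> (W x) (\<rho>0 x)"
    and \<tau>T: "\<And>x. x \<in> B \<Longrightarrow> p \<notin> \<tau> (W (f x)) (\<rho>0 (f x))"
    by blast
  \<comment> \<open>All levels are permuted at once. Sizes are preserved, so the arcs that climb are
    still those in \<open>B\<close>.\<close>
  define g where "g S = \<tau> (card S) S" for S
  have g: "g S \<in> ?L" "card (g S) = card S" if "S \<in> ?L" for S
    using bij_betw_apply[OF \<tau>, of S "card S"] that by (auto simp: g_def lev_def)
  have "inj_on g ?L"
  proof (rule inj_onI)
    fix S S' assume S: "S \<in> ?L" "S' \<in> ?L" and eq: "g S = g S'"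
    then have "card S = card S'" using g by metis
    moreover from this have "S \<in> lev (card S)" "S' \<in> lev (card S)" using S by (auto simp: lev_def)
    ultimately show "S = S'" using eq \<tau>[of "card S"] by (auto simp: g_def bij_betw_def dest: inj_onD)
  qed
  moreover have "g ` ?L \<subseteq> ?L" using g(1) by blast
  ultimately have "bij_betw g ?L ?L"
    unfolding bij_betw_def using endo_inj_surj[OF finite] by blast
  then have bij: "bij_betw (g \<circ> \<rho>0) ?R ?L" using \<rho>0 by (rule bij_betw_trans[rotated])
  have Wg: "card ((g \<circ> \<rho>0) x) = W x" if "x \<in> ?R" for x
    using g(2)[of "\<rho>0 x"] bij_betw_apply[OF \<rho>0 that] by (simp add: W_def)
  show ?thesis
  proof
    show "bij_betw (g \<circ> \<rho>0) ?R ?L" by (rule bij)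
    fix x assume "x \<notin> P" "f x \<notin> P"
    then have x: "x \<in> ?R" "f x \<in> ?R" by auto
    show "\<not> (g \<circ> \<rho>0) x \<subseteq> (g \<circ> \<rho>0) (f x)"
    proof
      assume le: "(g \<circ> \<rho>0) x \<subseteq> (g \<circ> \<rho>0) (f x)"
      then have "W x \<le> W (f x)" using Wg[OF x(1)] Wg[OF x(2)] card_mono[OF finite le] by simp
      moreover have "W x \<noteq> W (f x)"
      proof
        assume "W x = W (f x)"
        then have "(g \<circ> \<rho>0) x = (g \<circ> \<rho>0) (f x)"
          using Wg[OF x(1)] Wg[OF x(2)] card_subset_eq[OF finite le] by simp
        then have "x = f x" using bij x by (meson bij_betw_def inj_onD)
        then show False using nofix by metis
      qed
      ultimately have "x \<in> B" using x by (auto simp: B_def)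
      then have "p \<in> (g \<circ> \<rho>0) x" "p \<notin> (g \<circ> \<rho>0) (f x)"
        using \<tau>B \<tau>T by (auto simp: g_def W_def)
      then show False using le by blast
    qed
  qed
qed

section \<open>From labellings to asynchronous graphs\<close>

definition toggle :: "'n \<Rightarrow> 'n set \<Rightarrow> 'n set" where
  "toggle i S = (if i \<in> S then S - {i} else insert i S)"

definition trap :: "('n set \<Rightarrow> 'n set) \<Rightarrow> 'n set set \<Rightarrow> bool" where
  "trap H \<A> \<longleftrightarrow> (\<forall>S\<in>\<A>. \<forall>i. (i \<in> S) \<noteq> (i \<in> H S) \<longrightarrow> toggle i S \<in> \<A>)"

definition minimal_trap :: "('n set \<Rightarrow> 'n set) \<Rightarrow> 'n set set \<Rightarrow> bool" where
  "minimal_trap H \<A> \<longleftrightarrow> \<A> \<noteq> {} \<and> trap H \<A> \<and> (\<forall>\<B>. \<B> \<noteq> {} \<and> \<B> \<subseteq> \<A> \<and> trap H \<B> \<longrightarrow> \<B> = \<A>)"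

text \<open>Sets replace configurations because inclusion and cardinality then do the work of the
  order and of the levels of the cube.\<close>

definition conf_of :: "'n set \<Rightarrow> 'n conf" where
  "conf_of S = (\<lambda>i. i \<in> S)"

definition network_of :: "('n set \<Rightarrow> 'n set) \<Rightarrow> 'n conf \<Rightarrow> 'n conf" where
  "network_of H x = conf_of (H (Collect x))"

lemma Collect_conf_of [simp]: "Collect (conf_of S) = S"
  by (simp add: conf_of_def)

lemma conf_of_Collect [simp]: "conf_of (Collect x) = x"
  by (simp add: conf_of_def)

lemma bij_conf_of: "bij conf_of"
  by (rule bij_betw_byWitness[where f' = Collect]) auto

lemma conf_of_eq_iff [simp]: "conf_of S = conf_of T \<longleftrightarrow> S = T"
  by (metis Collect_conf_of)

lemma network_of_conf_of [simp]: "network_of H (conf_of S) = conf_of (H S)"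
  by (simp add: network_of_def)

lemma conf_of_add_unit: "conf_of S \<oplus>\<^sub>2 unit_conf i = conf_of (toggle i S)"
  by (auto simp: conf_of_def conf_add_def unit_conf_def toggle_def)

lemma increasing_arc_conf_of: "increasing_arc (conf_of S, conf_of T) \<longleftrightarrow> S \<subset> T"
  unfolding increasing_arc_def conf_of_def less_le_not_le le_fun_def by auto

lemma pverts_async_graph [simp]: "pverts (async_graph f) = UNIV"
  by (simp add: async_graph_def)

lemma async_arc_iff:
  "(conf_of S, conf_of T) \<in> parcs (async_graph (network_of H)) \<longleftrightarrow>
   (\<exists>i. T = toggle i S \<and> (i \<in> S) \<noteq> (i \<in> H S))" (is "?l \<longleftrightarrow> ?r")
proof -
  have "?l \<longleftrightarrow> (\<exists>i. conf_of T = conf_of S \<oplus>\<^sub>2 unit_conf i \<and>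
      network_of H (conf_of S) i \<noteq> conf_of S i)"
    by (auto simp: async_graph_def)
  also have "\<dots> \<longleftrightarrow> ?r"
    unfolding conf_of_add_unit network_of_conf_of conf_of_eq_iff by (auto simp: conf_of_def)
  finally show ?thesis .
qed

lemma no_leaving_arc_iff_trap:
  "no_leaving_arc (async_graph (network_of H)) (conf_of ` \<A>) \<longleftrightarrow> trap H \<A>" (is "?l \<longleftrightarrow> ?r")
proof
  assume l: ?l
  show ?r unfolding trap_def
  proof (intro ballI allI impI)
    fix S i assume "S \<in> \<A>" "(i \<in> S) \<noteq> (i \<in> H S)"
    moreover from this have "(conf_of S, conf_of (toggle i S)) \<in> parcs (async_graph (network_of H))"
      unfolding async_arc_iff by blast
    ultimately show "toggle i S \<in> \<A>" using l unfolding no_leaving_arc_def by auto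
  qed
next
  assume r: ?r
  show ?l unfolding no_leaving_arc_def
  proof (clarify)
    fix x y S assume *: "(conf_of S, y) \<in> parcs (async_graph (network_of H))" "y \<notin> conf_of ` \<A>" "S \<in> \<A>"
    obtain T where T: "y = conf_of T" by (metis conf_of_Collect)
    then show False using * r unfolding trap_def by (auto simp: async_arc_iff)
  qed
qed

lemma attractor_conf_of:
  assumes "minimal_trap H \<A>"
  shows "attractor (async_graph (network_of H)) (conf_of ` \<A>)"
  unfolding attractor_def
proof (intro conjI allI impI)
  show "conf_of ` \<A> \<subseteq> pverts (async_graph (network_of H))" by (simp add: async_graph_def)
  show "conf_of ` \<A> \<noteq> {}" "no_leaving_arc (async_graph (network_of H)) (conf_of ` \<A>)"
    using assms unfolding minimal_trap_def no_leaving_arc_iff_trap by auto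
  fix B assume B: "B \<noteq> {} \<and> B \<subseteq> conf_of ` \<A> \<and> no_leaving_arc (async_graph (network_of H)) B"
  obtain \<B> where \<B>: "B = conf_of ` \<B>" using B by (meson subset_imageE)
  then have "\<B> \<noteq> {}" "\<B> \<subseteq> \<A>" "trap H \<B>" using B by (auto simp: no_leaving_arc_iff_trap)
  then have "\<B> = \<A>" using assms unfolding minimal_trap_def by blast
  then show "B = conf_of ` \<A>" using \<B> by simp
qed

lemma isomorphic_conjugate:
  fixes f :: "'n conf \<Rightarrow> 'n conf" and \<pi> :: "'n conf \<Rightarrow> 'n conf"
  assumes "bij \<pi>" and "\<And>x. h (\<pi> x) = \<pi> (f x)"
  shows "h \<sim>\<^sub>S f"
proof -
  \<comment> \<open>The isomorphism must map the graph of \<open>h\<close> onto that of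
    \<open>f\<close>, hence the inverse.\<close>
  define \<phi> where "\<phi> = inv \<pi>"
  have inj: "inj \<phi>" and surj: "range \<phi> = UNIV"
    using assms(1) bij_imp_bij_inv unfolding \<phi>_def by (auto simp: bij_def)
  have \<phi>h: "\<phi> (h x) = f (\<phi> x)" for x
    using assms unfolding \<phi>_def by (metis bij_inv_eq_iff)
  define m where "m = \<lparr>iso_verts = \<phi>, iso_arcs = map_prod \<phi> \<phi>, iso_head = snd, iso_tail = fst\<rparr>"
  have "pre_digraph.digraph_isomorphism (with_proj (sync_graph h)) m"
    unfolding pre_digraph.digraph_isomorphism_def
  proof (intro conjI)
    show "wf_digraph (with_proj (sync_graph h))"
      by unfold_locales (auto simp: sync_graph_def)
    show "inj_on (iso_arcs m) (arcs (with_proj (sync_graph h)))"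
      using inj by (auto simp: m_def inj_on_def)
  qed (use inj in \<open>auto simp: m_def intro: inj_on_subset\<close>)
  moreover have "with_proj (sync_graph f) = app_iso m (with_proj (sync_graph h))"
  proof -
    have "parcs (sync_graph f) = map_prod \<phi> \<phi> ` parcs (sync_graph h)"
    proof (intro equalityI subsetI)
      fix a assume "a \<in> parcs (sync_graph f)"
      then obtain y where a: "a = (y, f y)" by (auto simp: sync_graph_def)
      obtain x where "y = \<phi> x" using surj by (metis surjD)
      then have "a = map_prod \<phi> \<phi> (x, h x)" using a \<phi>h by simp
      then show "a \<in> map_prod \<phi> \<phi> ` parcs (sync_graph h)" by (auto simp: sync_graph_def)
    next
      fix a assume "a \<in> map_prod \<phi> \<phi> ` parcs (sync_graph h)"
      then show "a \<in> parcs (sync_graph f)" using \<phi>h by (auto simp: sync_graph_def)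
    qed
    then show ?thesis using surj by (simp add: app_iso_def with_proj_def m_def sync_graph_def)
  qed
  ultimately show ?thesis unfolding isomorphic_networks_def digraph_iso_def by blast
qed

section \<open>Almost decreasing paths\<close>

text \<open>Removing closed subwalks only deletes arcs. Walks can therefore be concatenated freely
  and turned into paths at the very end without gaining increasing arcs.\<close>

lemma (in wf_digraph) apath_filter_le:
  assumes "awalk u p v"
  shows "\<exists>q. apath u q v \<and> length (filter P q) \<le> length (filter P p)"
  using assms
proof (induction rule: awalk_to_apath_induct)
  case (path p)
  then show ?case by (auto simp: apath_def)
next
  case (decomp p q r s)
  then have "p = q @ r @ s" using awalk_cyc_decompE by blast
  then show ?case using decomp.IH by fastforce
qed

text \<open>Dropping an element of \<open>S\<close> outside \<open>H S\<close> is a decreasing arc,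
  and this can only get stuck in \<open>\<A>\<close> or at \<open>E\<close>. The bound
  \<open>T \<subseteq> S\<close> is what later excludes a return to \<open>E\<close>.\<close>

lemma decreasing_walk:
  fixes H :: "'n::finite set \<Rightarrow> 'n set"
  assumes "\<And>S. S \<notin> \<A> \<Longrightarrow> S \<noteq> E \<Longrightarrow> \<not> S \<subseteq> H S"
  shows "\<exists>T p. pre_digraph.awalk (with_proj (async_graph (network_of H))) (conf_of S) p (conf_of T) \<and>
     filter increasing_arc p = [] \<and> T \<subseteq> S \<and> (T \<in> \<A> \<or> T = E)"
proof -
  interpret pair_wf_digraph "async_graph (network_of H)"
    by unfold_locales (auto simp: async_graph_def)
  have "finite S" by simp
  then show ?thesis
  proof (induction S rule: finite_psubset_induct)
    case (psubset S)
    show ?case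
    proof (cases "S \<in> \<A> \<or> S = E")
      case True
      then show ?thesis
        by (intro exI[of _ S] exI[of _ "[]"]) (auto simp: awalk_Nil_iff)
    next
      case False
      then obtain j where j: "j \<in> S" "j \<notin> H S" using assms by blast
      then obtain T p where T: "awalk (conf_of (S - {j})) p (conf_of T)"
        "filter increasing_arc p = []" "T \<subseteq> S - {j}" "T \<in> \<A> \<or> T = E"
        using psubset.IH[of "S - {j}"] by blast
      let ?a = "(conf_of S, conf_of (S - {j}))"
      have "?a \<in> parcs (async_graph (network_of H))"
        unfolding async_arc_iff using j by (auto simp: toggle_def)
      then have "awalk (conf_of S) (?a # p) (conf_of T)"
        using T(1) by (simp add: awalk_Cons_iff)
      moreover have "\<not> increasing_arc ?a" unfolding increasing_arc_conf_of by auto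
      ultimately show ?thesis using T
        by (intro exI[of _ T] exI[of _ "?a # p"]) auto
    qed
  qed
qed

text \<open>A walk that reaches \<open>E\<close> is continued by adding \<open>i\<close>. If this
  misses \<open>\<A>\<close>, an element \<open>j\<close> of \<open>E\<close> is dropped next; all
  labels below the result lack \<open>j\<close>, so the following decreasing walk cannot end in
  \<open>E\<close> again and one increasing arc is enough.\<close>

lemma almost_decreasing_path_to_trap:
  fixes H :: "'n::finite set \<Rightarrow> 'n set"
  assumes dec: "\<And>S. S \<notin> \<A> \<Longrightarrow> S \<noteq> E \<Longrightarrow> \<not> S \<subseteq> H S"
    and E: "E \<in> \<A> \<or> (\<exists>i. i \<notin> E \<and> i \<in> H E \<and> (insert i E \<in> \<A> \<or> (\<exists>j\<in>E. j \<notin> H (insert i E))))"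
  shows "\<exists>T\<in>\<A>. \<exists>p. almost_decreasing_path (async_graph (network_of H)) (conf_of S) p (conf_of T)"
proof -
  interpret pair_wf_digraph "async_graph (network_of H)"
    by unfold_locales (auto simp: async_graph_def)
  note walk = decreasing_walk[of \<A> E H, OF dec]
  have "\<exists>T\<in>\<A>. \<exists>p. awalk (conf_of E) p (conf_of T) \<and> length (filter increasing_arc p) \<le> 1"
  proof (cases "E \<in> \<A>")
    case True
    then show ?thesis
      by (intro bexI[of _ E] exI[of _ "[]"]) (auto simp: awalk_Nil_iff)
  next
    case False
    then obtain i where i: "i \<notin> E" "i \<in> H E"
      and down: "insert i E \<in> \<A> \<or> (\<exists>j\<in>E. j \<notin> H (insert i E))" using E by blast
    let ?a = "(conf_of E, conf_of (insert i E))"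
    have a: "?a \<in> parcs (async_graph (network_of H))"
      unfolding async_arc_iff using i by (auto simp: toggle_def)
    from down show ?thesis
    proof
      assume "insert i E \<in> \<A>"
      then show ?thesis using a
        by (intro bexI[of _ "insert i E"] exI[of _ "[?a]"])
          (auto simp: awalk_Cons_iff awalk_Nil_iff)
    next
      assume "\<exists>j\<in>E. j \<notin> H (insert i E)"
      then obtain j where j: "j \<in> E" "j \<notin> H (insert i E)" by blast
      let ?S = "insert i E - {j}"
      let ?b = "(conf_of (insert i E), conf_of ?S)"
      have b: "?b \<in> parcs (async_graph (network_of H))"
        unfolding async_arc_iff using j by (auto simp: toggle_def)
      obtain T p where T: "awalk (conf_of ?S) p (conf_of T)"
        "filter increasing_arc p = []" "T \<subseteq> ?S" "T \<in> \<A> \<or> T = E"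
        using walk by blast
      have "T \<in> \<A>" using T(3,4) j by blast
      moreover have "awalk (conf_of E) (?a # ?b # p) (conf_of T)"
        using T(1) a b by (simp add: awalk_Cons_iff)
      moreover have "\<not> increasing_arc ?b" unfolding increasing_arc_conf_of using j i by auto
      ultimately show ?thesis using T(2)
        by (intro bexI[of _ T] exI[of _ "?a # ?b # p"]) auto
    qed
  qed
  then obtain T1 p1 where p1: "T1 \<in> \<A>" "awalk (conf_of E) p1 (conf_of T1)"
    "length (filter increasing_arc p1) \<le> 1" by blast
  obtain T p where T: "awalk (conf_of S) p (conf_of T)"
    "filter increasing_arc p = []" "T \<in> \<A> \<or> T = E"
    using walk by blast
  have "\<exists>T\<in>\<A>. \<exists>p. awalk (conf_of S) p (conf_of T) \<and> length (filter increasing_arc p) \<le> 1"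
  proof (cases "T \<in> \<A>")
    case True
    then show ?thesis using T by (intro bexI[of _ T] exI[of _ p]) auto
  next
    case False
    then have "awalk (conf_of S) (p @ p1) (conf_of T1)" using T p1 by (auto intro: awalk_appendI)
    then show ?thesis using T p1 by (intro bexI[of _ T1] exI[of _ "p @ p1"]) auto
  qed
  then obtain T2 p2 where p2: "T2 \<in> \<A>" "awalk (conf_of S) p2 (conf_of T2)"
    "length (filter increasing_arc p2) \<le> 1" by blast
  obtain q where "apath (conf_of S) q (conf_of T2)"
    "length (filter increasing_arc q) \<le> length (filter increasing_arc p2)"
    using apath_filter_le[OF p2(2)] by blast
  then show ?thesis
    using p2 unfolding almost_decreasing_path_def by (intro bexI[of _ T2] exI[of _ q]) auto
qed

definition attracted_up_to_iso :: "('n conf \<Rightarrow> 'n conf) \<Rightarrow> bool" where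
  "attracted_up_to_iso f \<longleftrightarrow> (\<exists>h :: 'n conf \<Rightarrow> 'n conf. h \<sim>\<^sub>S f \<and>
    (\<exists>A. attractor (async_graph h) A \<and> card A \<le> 4 \<and>
      (\<forall>x. \<exists>y\<in>A. \<exists>p. almost_decreasing_path (async_graph h) x p y)))"

text \<open>\<open>H\<close> is \<open>f\<close> transported along \<open>\<pi>\<close>, so
  decreasing arcs can be checked on points. Choosing \<open>E\<close> in \<open>\<A>\<close>
  expresses that no exceptional point is needed.\<close>

lemma attracted_if_labelling:
  fixes f :: "'n::finite conf \<Rightarrow> 'n conf" and \<pi> :: "'n conf \<Rightarrow> 'n set"
  assumes \<pi>: "bij \<pi>" and H: "\<And>x. H (\<pi> x) = \<pi> (f x)"
    and \<A>: "minimal_trap H \<A>" "card \<A> \<le> 4"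
    and dec: "\<And>x. \<pi> x \<notin> \<A> \<Longrightarrow> \<pi> x \<noteq> E \<Longrightarrow> \<not> \<pi> x \<subseteq> \<pi> (f x)"
    and E: "E \<in> \<A> \<or> (\<exists>i. i \<notin> E \<and> i \<in> H E \<and> (insert i E \<in> \<A> \<or> (\<exists>j\<in>E. j \<notin> H (insert i E))))"
  shows "attracted_up_to_iso f"
  unfolding attracted_up_to_iso_def
proof (intro exI[of _ "network_of H"] exI[of _ "conf_of ` \<A>"] conjI allI)
  show "network_of H \<sim>\<^sub>S f"
    by (rule isomorphic_conjugate[of "conf_of \<circ> \<pi>"]) (use \<pi> bij_conf_of H in \<open>auto intro: bij_comp\<close>)
  show "attractor (async_graph (network_of H)) (conf_of ` \<A>)"
    using \<A> by (intro attractor_conf_of)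
  show "card (conf_of ` \<A>) \<le> 4"
    using \<A>(2) by (subst card_image) (auto simp: inj_on_def)
  fix x
  have dec': "\<not> S \<subseteq> H S" if "S \<notin> \<A>" "S \<noteq> E" for S
  proof -
    obtain y where "S = \<pi> y" using \<pi> by (metis bij_pointE)
    then show ?thesis using dec[of y] that by (simp add: H)
  qed
  obtain T p where "T \<in> \<A>"
    "almost_decreasing_path (async_graph (network_of H)) (conf_of (Collect x)) p (conf_of T)"
    using almost_decreasing_path_to_trap[of \<A> E H, OF dec' E] by blast
  then show "\<exists>y\<in>conf_of ` \<A>. \<exists>p. almost_decreasing_path (async_graph (network_of H)) x p y"
    by auto
qed

section \<open>Small attractors\<close>

lemma minimal_trap_edge:
  assumes "H {} = {i}" and "H {i} = {}"
  shows "minimal_trap H {{}, {i}}"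
proof -
  have "trap H {{}, {i}}" using assms by (auto simp: trap_def toggle_def)
  moreover have "\<B> = {{}, {i}}" if "\<B> \<noteq> {}" "\<B> \<subseteq> {{}, {i}}" and tr: "trap H \<B>" for \<B>
  proof -
    have step: "toggle l S \<in> \<B>" if "S \<in> \<B>" "(l \<in> S) \<noteq> (l \<in> H S)" for S l
      using tr that unfolding trap_def by blast
    have "{} \<in> \<B> \<Longrightarrow> {i} \<in> \<B>" "{i} \<in> \<B> \<Longrightarrow> {} \<in> \<B>"
      using step[of "{}" i] step[of "{i}" i] assms by (auto simp: toggle_def)
    then show ?thesis using that by blast
  qed
  ultimately show ?thesis unfolding minimal_trap_def by blast
qed

text \<open>Both ends have the centre \<open>{i}\<close> as image and can only move there. The image
  \<open>{j}\<close> of the centre differs from it in \<open>i\<close> and \<open>j\<close>, which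
  gives the moves to the two ends.\<close>

lemma minimal_trap_path3:
  assumes "i \<noteq> j" and "H {} = {i}" and "H {i} = {j}" and "H {i, j} = {i}"
  shows "minimal_trap H {{}, {i}, {i, j}}"
proof -
  have "trap H {{}, {i}, {i, j}}"
    using assms by (auto simp: trap_def toggle_def insert_commute insert_Diff_if)
  moreover have "\<B> = {{}, {i}, {i, j}}"
    if "\<B> \<noteq> {}" "\<B> \<subseteq> {{}, {i}, {i, j}}" and tr: "trap H \<B>" for \<B>
  proof -
    have step: "toggle l S \<in> \<B>" if "S \<in> \<B>" "(l \<in> S) \<noteq> (l \<in> H S)" for S l
      using tr that unfolding trap_def by blast
    have "{} \<in> \<B> \<Longrightarrow> {i} \<in> \<B>" using step[of "{}" i] assms by (simp add: toggle_def)
    moreover have "{i} \<in> \<B> \<Longrightarrow> {} \<in> \<B>" using step[of "{i}" i] assms by (simp add: toggle_def)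
    moreover have "{i} \<in> \<B> \<Longrightarrow> {i, j} \<in> \<B>"
      using step[of "{i}" j] assms by (simp add: toggle_def insert_commute)
    moreover have "{i, j} \<in> \<B> \<Longrightarrow> {i} \<in> \<B>"
      using step[of "{i, j}" j] assms by (simp add: toggle_def insert_Diff_if)
    ultimately show ?thesis using that by blast
  qed
  ultimately show ?thesis unfolding minimal_trap_def by blast
qed

text \<open>No image is repeated here: \<open>{i}\<close>, \<open>{}\<close>, \<open>{i, j}\<close>
  and \<open>{j, k}\<close>, \<open>{j}\<close>, \<open>{k}\<close> are two stretches along
  \<open>H\<close>, as a permutation allows. The inner vertices \<open>{}\<close> and
  \<open>{j}\<close> can move both ways, the outer ones only inwards.\<close>

lemma minimal_trap_path4:
  assumes "i \<noteq> j" and "i \<noteq> k" and "j \<noteq> k"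
    and "H {i} = {}" and "H {} = {i, j}" and "H {j} = {k}" and "H {j, k} = {j}"
  shows "minimal_trap H {{i}, {}, {j}, {j, k}}"
proof -
  have "trap H {{i}, {}, {j}, {j, k}}"
    using assms by (auto simp: trap_def toggle_def insert_commute insert_Diff_if)
  moreover have "\<B> = {{i}, {}, {j}, {j, k}}"
    if "\<B> \<noteq> {}" "\<B> \<subseteq> {{i}, {}, {j}, {j, k}}" and tr: "trap H \<B>" for \<B>
  proof -
    have step: "toggle l S \<in> \<B>" if "S \<in> \<B>" "(l \<in> S) \<noteq> (l \<in> H S)" for S l
      using tr that unfolding trap_def by blast
    have "{i} \<in> \<B> \<Longrightarrow> {} \<in> \<B>" using step[of "{i}" i] assms by (simp add: toggle_def)
    moreover have "{} \<in> \<B> \<Longrightarrow> {i} \<in> \<B>" using step[of "{}" i] assms by (simp add: toggle_def)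
    moreover have "{} \<in> \<B> \<Longrightarrow> {j} \<in> \<B>" using step[of "{}" j] assms by (simp add: toggle_def)
    moreover have "{j} \<in> \<B> \<Longrightarrow> {} \<in> \<B>" using step[of "{j}" j] assms by (simp add: toggle_def)
    moreover have "{j} \<in> \<B> \<Longrightarrow> {j, k} \<in> \<B>"
      using step[of "{j}" k] assms by (simp add: toggle_def insert_commute)
    moreover have "{j, k} \<in> \<B> \<Longrightarrow> {j} \<in> \<B>"
      using step[of "{j, k}" k] assms by (simp add: toggle_def insert_Diff_if)
    ultimately show ?thesis using that by blast
  qed
  ultimately show ?thesis unfolding minimal_trap_def by blast
qed

section \<open>Extending a partial labelling\<close>

text \<open>A point outside \<open>ps\<close> has a label outside \<open>ps\<close>. If its image
  has label \<open>S\<close> and every subset of \<open>S\<close> occurs in \<open>ps\<close>, its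
  own label is not below \<open>S\<close>. \<open>low\<close> demands this only for images of points
  outside \<open>ps\<close>, so large labels may be prescribed where all preimages are prescribed
  too.\<close>

lemma glue_labelling:
  fixes f :: "'n::finite conf \<Rightarrow> 'n conf" and ps :: "('n conf \<times> 'n set) list"
  assumes dist: "distinct (map fst ps)" "distinct (map snd ps)"
    and \<rho>: "bij_betw \<rho> (- fst ` set ps) (- snd ` set ps)"
    and dec: "\<And>x. x \<notin> fst ` set ps \<Longrightarrow> f x \<notin> fst ` set ps \<Longrightarrow> \<not> \<rho> x \<subseteq> \<rho> (f x)"
    and low: "\<And>x S T. (f x, S) \<in> set ps \<Longrightarrow> x \<notin> fst ` set ps \<Longrightarrow> T \<subseteq> S \<Longrightarrow> T \<in> snd ` set ps"
  obtains \<pi> where "bij \<pi>" and "\<And>x S. (x, S) \<in> set ps \<Longrightarrow> \<pi> x = S"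
    and "\<And>x. x \<notin> fst ` set ps \<Longrightarrow> \<pi> x = \<rho> x"
    and "\<And>x. x \<notin> fst ` set ps \<Longrightarrow> \<not> \<pi> x \<subseteq> \<pi> (f x)"
proof -
  define \<pi> where "\<pi> x = (if x \<in> fst ` set ps then the (map_of ps x) else \<rho> x)" for x
  have in_ps: "\<pi> x = S" if "(x, S) \<in> set ps" for x S
  proof -
    have "x \<in> fst ` set ps" using that by force
    then show ?thesis using that dist(1) by (simp add: \<pi>_def)
  qed
  have out: "\<pi> x = \<rho> x" if "x \<notin> fst ` set ps" for x using that by (simp add: \<pi>_def)
  have "inj_on \<pi> (fst ` set ps)"
  proof (rule inj_onI, clarsimp)
    fix x S y T assume *: "(x, S) \<in> set ps" "(y, T) \<in> set ps" "\<pi> x = \<pi> y"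
    then have "S = T" using in_ps by metis
    then have "(x, S) = (y, T)"
      using * dist(2) by (metis distinct_map inj_onD snd_conv)
    then show "x = y" by simp
  qed
  moreover have "\<pi> ` fst ` set ps = snd ` set ps"
    using in_ps by (force simp: image_iff)
  ultimately have "bij_betw \<pi> (fst ` set ps) (snd ` set ps)" by (simp add: bij_betw_def)
  moreover have "bij_betw \<pi> (- fst ` set ps) (- snd ` set ps)"
    using \<rho> by (rule bij_betw_cong[THEN iffD1, rotated]) (simp add: out)
  ultimately have "bij_betw \<pi> (fst ` set ps \<union> - fst ` set ps) (snd ` set ps \<union> - snd ` set ps)"
    by (rule bij_betw_combine) simp
  then have "bij \<pi>" by simp
  moreover have "\<not> \<pi> x \<subseteq> \<pi> (f x)" if x: "x \<notin> fst ` set ps" for x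
  proof (cases "f x \<in> fst ` set ps")
    case True
    then obtain S where S: "(f x, S) \<in> set ps" by force
    have "\<pi> x \<notin> snd ` set ps" using bij_betw_apply[OF \<rho>, of x] out x by simp
    then show ?thesis using low[OF S x] in_ps[OF S] by metis
  next
    case False
    then show ?thesis using dec x out by simp
  qed
  ultimately show ?thesis using that in_ps out by blast
qed

lemma card_Compl_eq:
  fixes P :: "'n::finite conf set" and K :: "'n set set"
  assumes "card P = card K"
  shows "card (- P) = card (- K)"
proof -
  have "CARD('n set) = CARD('n conf)" by (rule bij_betw_same_card[OF bij_conf_of])
  then show ?thesis using assms by (simp add: Compl_eq_Diff_UNIV card_Diff_subset)
qed

text \<open>Stated apart from the glueing because one case fixes the final assignment only after
  inspecting \<open>\<rho>\<close>.\<close>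

lemma label_outside_assignment:
  fixes f :: "'n::finite conf \<Rightarrow> 'n conf" and ps :: "('n conf \<times> 'n set) list"
  assumes nofix: "\<And>x. f x \<noteq> x"
    and dist: "distinct (map fst ps)" "distinct (map snd ps)"
    and K: "{} \<in> snd ` set ps" "UNIV \<in> snd ` set ps"
    and Kp: "\<forall>(x, S)\<in>set ps. p \<in> S \<longrightarrow> CARD('n) \<le> Suc (card S)"
    and Kst: "\<forall>(x, S)\<in>set ps. s \<in> S \<longrightarrow> t \<in> S \<longrightarrow> p \<in> S"
    and st: "s \<noteq> p" "t \<noteq> p"
  obtains \<rho> where "bij_betw \<rho> (- fst ` set ps) (- snd ` set ps)"
    and "\<And>x. x \<notin> fst ` set ps \<Longrightarrow> f x \<notin> fst ` set ps \<Longrightarrow> \<not> \<rho> x \<subseteq> \<rho> (f x)"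
proof -
  have "card (fst ` set ps) = card (snd ` set ps)"
    using dist by (metis distinct_card length_map list.set_map)
  then have card: "card (- fst ` set ps) = card (- snd ` set ps)" by (rule card_Compl_eq)
  show ?thesis
  proof (rule label_remaining_points[of f "fst ` set ps" "snd ` set ps" p s t, OF nofix card K _ _ st])
    show "CARD('n) \<le> Suc (card S)" if "S \<in> snd ` set ps" "p \<in> S" for S
      using Kp that by auto
    show "S \<notin> snd ` set ps" if "s \<in> S" "t \<in> S" "p \<notin> S" for S
      using Kst that by auto
  qed (use that in blast)
qed

lemma extend_assignment:
  fixes f :: "'n::finite conf \<Rightarrow> 'n conf" and ps :: "('n conf \<times> 'n set) list"
  assumes nofix: "\<And>x. f x \<noteq> x"
    and dist: "distinct (map fst ps)" "distinct (map snd ps)"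
    and K: "{} \<in> snd ` set ps" "UNIV \<in> snd ` set ps"
    and Kp: "\<forall>(x, S)\<in>set ps. p \<in> S \<longrightarrow> CARD('n) \<le> Suc (card S)"
    and Kst: "\<forall>(x, S)\<in>set ps. s \<in> S \<longrightarrow> t \<in> S \<longrightarrow> p \<in> S"
    and st: "s \<noteq> p" "t \<noteq> p"
    and low: "\<And>x S T. (f x, S) \<in> set ps \<Longrightarrow> x \<notin> fst ` set ps \<Longrightarrow> T \<subseteq> S \<Longrightarrow> T \<in> snd ` set ps"
  obtains \<pi> where "bij \<pi>" and "\<And>x S. (x, S) \<in> set ps \<Longrightarrow> \<pi> x = S"
    and "\<And>x. x \<notin> fst ` set ps \<Longrightarrow> \<not> \<pi> x \<subseteq> \<pi> (f x)"
proof -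
  obtain \<rho> where \<rho>: "bij_betw \<rho> (- fst ` set ps) (- snd ` set ps)"
    "\<And>x. x \<notin> fst ` set ps \<Longrightarrow> f x \<notin> fst ` set ps \<Longrightarrow> \<not> \<rho> x \<subseteq> \<rho> (f x)"
    using label_outside_assignment[of f ps p s t, OF nofix dist K Kp Kst st] by blast
  show ?thesis
    by (rule glue_labelling[of ps \<rho> f, OF dist \<rho> low]) (use that in blast)+
qed

section \<open>Placing the attractor\<close>

lemma subset_doubleton: "T \<subseteq> {a, b} \<longleftrightarrow> T = {} \<or> T = {a} \<or> T = {b} \<or> T = {a, b}"
  by blast

text \<open>The small prescribed labels are built from \<open>i\<close>, \<open>j\<close>,
  \<open>k\<close>, while \<open>p\<close> occurs only in the full label and in complements of
  singletons. As \<open>{i, j}\<close> and \<open>{j, k}\<close> are both used, \<open>i\<close> and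
  \<open>k\<close> form the pair that no prescribed label contains without \<open>p\<close>; they
  are passed as \<open>s\<close> and \<open>t\<close> throughout.\<close>

locale labels =
  fixes f :: "'n::finite conf \<Rightarrow> 'n conf" and i j k p :: 'n
  assumes nofix: "f x \<noteq> x"
    and ijkp: "i \<noteq> j" "i \<noteq> k" "j \<noteq> k" "i \<noteq> p" "j \<noteq> p" "k \<noteq> p"
begin

lemma card_cosingleton: "CARD('n) \<le> Suc (card (- {l :: 'n}))"
  by (simp add: Compl_eq_Diff_UNIV card_Diff_subset)

text \<open>In each inequality \<open>p\<close> belongs to exactly one of the two sets.\<close>

lemma p_separates:
  "{i} \<noteq> UNIV" "{j} \<noteq> UNIV" "{k} \<noteq> UNIV" "{i, j} \<noteq> UNIV" "{j, k} \<noteq> UNIV"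
  "{} \<noteq> - {i}" "{i} \<noteq> - {i}" "{j} \<noteq> - {i}" "{k} \<noteq> - {i}" "{i, j} \<noteq> - {i}" "{j, k} \<noteq> - {i}"
  "{} \<noteq> - {j}" "{i} \<noteq> - {j}" "{j} \<noteq> - {j}"
  "{} \<noteq> - {k}" "{i} \<noteq> - {k}" "{j} \<noteq> - {k}" "{k} \<noteq> - {k}" "{i, j} \<noteq> - {k}"
  by (rule notI, drule arg_cong[where f = "\<lambda>S. p \<in> S"], use ijkp in simp)+

lemma Compl_singleton_neq_UNIV: "- {l} \<noteq> UNIV"
  by auto

lemmas label_neq = Compl_singleton_neq_UNIV ijkp ijkp[symmetric] p_separates p_separates[symmetric] doubleton_eq_iff

lemma not_UNIV_subset:
  assumes "bij \<pi>" and "\<pi> q = UNIV"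
  shows "\<not> UNIV \<subseteq> \<pi> (f q)"
  using assms nofix[of q] by (metis bij_def injD top.extremum_uniqueI)

text \<open>Only two labels contain \<open>- {l}\<close>, and both are taken by points other than
  \<open>x\<close>.\<close>

lemma coatom_not_subset:
  fixes \<pi> :: "'n conf \<Rightarrow> 'n set"
  assumes "bij \<pi>" and "\<pi> y = - {l}" and "\<pi> q = UNIV" and "x \<noteq> y" and "x \<noteq> q"
  shows "\<exists>m\<in>- {l}. m \<notin> \<pi> x"
proof (rule ccontr)
  assume "\<not> ?thesis"
  then have "\<pi> x = - {l} \<or> \<pi> x = UNIV" by blast
  then show False using assms by (metis bij_def injD)
qed

lemma card_conf_ge: "16 \<le> CARD('n conf)"
proof -
  have "4 \<le> CARD('n)" using card_mono[of UNIV "{i, j, k, p}"] ijkp by simp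
  then have "2 ^ 4 \<le> (2 :: nat) ^ CARD('n)" by (intro power_increasing) auto
  then show ?thesis by (simp add: card_fun)
qed

lemma ex_not_in_list:
  assumes "length (xs :: 'n conf list) < 16"
  shows "\<exists>x. x \<notin> set xs"
proof -
  have "card (set xs) < CARD('n conf)"
    using assms card_length[of xs] card_conf_ge by linarith
  then have "set xs \<noteq> UNIV" by auto
  then show ?thesis by auto
qed

section \<open>Networks with a 2-cycle\<close>

text \<open>As nothing maps to \<open>q\<close>, giving it the full label creates no ascent, and
  \<open>E\<close> can be taken in the attractor.\<close>

lemma attracted_if_two_cycle_not_surj:
  assumes "f (f s) = s" and "q \<notin> range f"
  shows "attracted_up_to_iso f"
proof -
  define t where "t = f s"
  let ?ps = "[(s, {}), (t, {i}), (q, UNIV)]"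
  have d: "s \<noteq> t" "s \<noteq> q" "t \<noteq> q" "f s = t" "f t = s"
    using assms nofix[of s] unfolding t_def by (metis rangeI)+
  have fq: "f x \<noteq> q" for x using assms(2) by auto
  obtain \<pi> where \<pi>: "bij \<pi>" "\<And>x S. (x, S) \<in> set ?ps \<Longrightarrow> \<pi> x = S"
    and dec: "\<And>x. x \<notin> fst ` set ?ps \<Longrightarrow> \<not> \<pi> x \<subseteq> \<pi> (f x)"
  proof (rule extend_assignment[of f ?ps p i k])
    show "T \<in> snd ` set ?ps" if "(f x, S) \<in> set ?ps" "x \<notin> fst ` set ?ps" "T \<subseteq> S" for x S T
      using that fq[of x] by (auto simp: subset_singleton_iff)
    show "distinct (map fst ?ps)" using d by simp
    show "distinct (map snd ?ps)" using label_neq by simp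
    show "\<forall>(x, S)\<in>set ?ps. p \<in> S \<longrightarrow> CARD('n) \<le> Suc (card S)"
      using ijkp card_cosingleton by simp
    show "\<forall>(x, S)\<in>set ?ps. i \<in> S \<longrightarrow> k \<in> S \<longrightarrow> p \<in> S" using ijkp by simp
  qed (use ijkp nofix in simp_all)
  have lab: "\<pi> s = {}" "\<pi> t = {i}" "\<pi> q = UNIV" using \<pi>(2) by auto
  define H where "H S = \<pi> (f (inv \<pi> S))" for S
  have H: "H (\<pi> x) = \<pi> (f x)" for x using \<pi>(1) by (simp add: H_def bij_is_inj)
  show ?thesis
  proof (rule attracted_if_labelling[of \<pi> H f "{{}, {i}}" "{}"])
    show "minimal_trap H {{}, {i}}"
      using H[of s] H[of t] d lab by (intro minimal_trap_edge) auto
    show "\<not> \<pi> x \<subseteq> \<pi> (f x)" if "\<pi> x \<notin> {{}, {i}}" for x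
      using dec[of x] that lab not_UNIV_subset[OF \<pi>(1) lab(3)] by (cases "x \<in> {s, t, q}") auto
  qed (use \<pi>(1) H in \<open>auto simp: card_insert_if\<close>)
qed

lemma attracted_if_two_cycle_bij:
  assumes "inj f" and "f (f s) = s" and "f (f z) \<noteq> z"
  shows "attracted_up_to_iso f"
proof -
  define t where "t = f s"
  define y where "y = f z"
  define q where "q = f y"
  let ?ps = "[(s, {}), (t, {i}), (z, {j}), (y, - {j}), (q, UNIV)]"
  have f: "f s = t" "f t = s" "f z = y" "f y = q" using assms unfolding t_def y_def q_def by auto
  have inj: "f a = f b \<longleftrightarrow> a = b" for a b using assms(1) by (auto dest: injD)
  have d: "s \<noteq> t" "z \<noteq> y" "y \<noteq> q" "z \<noteq> q"
    using f nofix assms(3) by metis+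
  have "z \<noteq> s" "z \<noteq> t" using f assms(3) by auto
  then have "y \<noteq> t" "y \<noteq> s" using f inj by metis+
  then have "q \<noteq> s" "q \<noteq> t" using f inj by metis+
  note d = d \<open>z \<noteq> s\<close> \<open>z \<noteq> t\<close> \<open>y \<noteq> t\<close> \<open>y \<noteq> s\<close> \<open>q \<noteq> s\<close> \<open>q \<noteq> t\<close>
  have pre: "f x = s \<longleftrightarrow> x = t" "f x = t \<longleftrightarrow> x = s" "f x = y \<longleftrightarrow> x = z" "f x = q \<longleftrightarrow> x = y" for x
    using f inj by metis+
  obtain \<pi> where \<pi>: "bij \<pi>" "\<And>x S. (x, S) \<in> set ?ps \<Longrightarrow> \<pi> x = S"
    and dec: "\<And>x. x \<notin> fst ` set ?ps \<Longrightarrow> \<not> \<pi> x \<subseteq> \<pi> (f x)"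
  proof (rule extend_assignment[of f ?ps p i k])
    show "T \<in> snd ` set ?ps" if "(f x, S) \<in> set ?ps" "x \<notin> fst ` set ?ps" "T \<subseteq> S" for x S T
      using that pre[of x] by (auto simp: subset_singleton_iff)
    show "distinct (map fst ?ps)" using d by simp
    show "distinct (map snd ?ps)" using label_neq by simp
    show "\<forall>(x, S)\<in>set ?ps. p \<in> S \<longrightarrow> CARD('n) \<le> Suc (card S)"
      using ijkp card_cosingleton by simp
    show "\<forall>(x, S)\<in>set ?ps. i \<in> S \<longrightarrow> k \<in> S \<longrightarrow> p \<in> S" using ijkp by simp
  qed (use ijkp nofix in simp_all)
  have lab: "\<pi> s = {}" "\<pi> t = {i}" "\<pi> z = {j}" "\<pi> y = - {j}" "\<pi> q = UNIV" using \<pi>(2) by auto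
  define H where "H S = \<pi> (f (inv \<pi> S))" for S
  have H: "H (\<pi> x) = \<pi> (f x)" for x using \<pi>(1) by (simp add: H_def bij_is_inj)
  show ?thesis
  proof (rule attracted_if_labelling[of \<pi> H f "{{}, {i}}" "- {j}"])
    show "minimal_trap H {{}, {i}}"
      using H[of s] H[of t] f lab by (intro minimal_trap_edge) auto
    show "\<not> \<pi> x \<subseteq> \<pi> (f x)" if "\<pi> x \<notin> {{}, {i}}" "\<pi> x \<noteq> - {j}" for x
      using dec[of x] that lab f not_UNIV_subset[OF \<pi>(1) lab(5)]
      by (cases "x \<in> {s, t, z, y, q}") auto
    have "f q \<noteq> y" "f q \<noteq> q" using pre d nofix by auto
    then have "\<exists>m\<in>- {j}. m \<notin> H (insert j (- {j}))"
      using coatom_not_subset[OF \<pi>(1) lab(4,5)] H[of q] lab by (simp add: Compl_insert)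
    then show "- {j} \<in> {{}, {i}} \<or> (\<exists>i'. i' \<notin> - {j} \<and> i' \<in> H (- {j}) \<and>
        (insert i' (- {j}) \<in> {{}, {i}} \<or> (\<exists>m\<in>- {j}. m \<notin> H (insert i' (- {j})))))"
      using H[of y] f lab by auto
  qed (use \<pi>(1) H in \<open>auto simp: card_insert_if\<close>)
qed

text \<open>A coatom whose image is the full label would be led back to itself by an involution.
  Instead \<open>E\<close> is \<open>{j}\<close>: adding \<open>i\<close> gives
  \<open>{i, j}\<close>, whose image \<open>{k}\<close> allows \<open>j\<close> to be dropped,
  ending at \<open>{i}\<close>. Three 2-cycles are labelled completely, so no other point maps into
  them.\<close>

lemma attracted_if_involution:
  assumes inv: "\<And>x. f (f x) = x"
  shows "attracted_up_to_iso f"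
proof -
  define s :: "'n conf" where "s = undefined"
  define t where "t = f s"
  obtain y where y: "y \<notin> {s, t}" using ex_not_in_list[of "[s, t]"] by auto
  define q where "q = f y"
  obtain c where c: "c \<notin> {s, t, y, q}" using ex_not_in_list[of "[s, t, y, q]"] by auto
  define d where "d = f c"
  let ?ps = "[(s, {}), (t, {i}), (y, {j}), (q, UNIV), (c, {k}), (d, {i, j})]"
  have f: "f s = t" "f t = s" "f y = q" "f q = y" "f c = d" "f d = c"
    using inv unfolding t_def q_def d_def by auto
  have pre: "f x = a \<longleftrightarrow> x = f a" for x a using inv by metis
  have ne: "s \<noteq> t" "y \<noteq> q" "c \<noteq> d" "y \<noteq> s" "y \<noteq> t" "q \<noteq> s" "q \<noteq> t"
    "c \<noteq> s" "c \<noteq> t" "c \<noteq> y" "c \<noteq> q" "d \<noteq> s" "d \<noteq> t" "d \<noteq> y" "d \<noteq> q"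
    using f nofix y c inv by (metis insertCI)+
  obtain \<pi> where \<pi>: "bij \<pi>" "\<And>x S. (x, S) \<in> set ?ps \<Longrightarrow> \<pi> x = S"
    and dec: "\<And>x. x \<notin> fst ` set ?ps \<Longrightarrow> \<not> \<pi> x \<subseteq> \<pi> (f x)"
  proof (rule extend_assignment[of f ?ps p i k])
    show "T \<in> snd ` set ?ps" if "(f x, S) \<in> set ?ps" "x \<notin> fst ` set ?ps" "T \<subseteq> S" for x S T
      using that pre[of x] f by auto
    show "distinct (map fst ?ps)" using ne by simp
    show "distinct (map snd ?ps)" using label_neq by simp
    show "\<forall>(x, S)\<in>set ?ps. p \<in> S \<longrightarrow> CARD('n) \<le> Suc (card S)"
      using ijkp card_cosingleton by simp
    show "\<forall>(x, S)\<in>set ?ps. i \<in> S \<longrightarrow> k \<in> S \<longrightarrow> p \<in> S" using ijkp by simp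
  qed (use ijkp nofix in simp_all)
  have lab: "\<pi> s = {}" "\<pi> t = {i}" "\<pi> y = {j}" "\<pi> q = UNIV" "\<pi> c = {k}" "\<pi> d = {i, j}"
    using \<pi>(2) by auto
  define H where "H S = \<pi> (f (inv \<pi> S))" for S
  have H: "H (\<pi> x) = \<pi> (f x)" for x using \<pi>(1) by (simp add: H_def bij_is_inj)
  show ?thesis
  proof (rule attracted_if_labelling[of \<pi> H f "{{}, {i}}" "{j}"])
    show "minimal_trap H {{}, {i}}"
      using H[of s] H[of t] f lab by (intro minimal_trap_edge) auto
    show "\<not> \<pi> x \<subseteq> \<pi> (f x)" if "\<pi> x \<notin> {{}, {i}}" "\<pi> x \<noteq> {j}" for x
      using dec[of x] that lab f ijkp not_UNIV_subset[OF \<pi>(1) lab(4)]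
      by (cases "x \<in> {s, t, y, q, c, d}") auto
    have "i \<notin> {j} \<and> i \<in> H {j} \<and> (\<exists>m\<in>{j}. m \<notin> H (insert i {j}))"
      using H[of y] H[of d] f lab ijkp by auto
    then show "{j} \<in> {{}, {i}} \<or> (\<exists>i'. i' \<notin> {j} \<and> i' \<in> H {j} \<and>
        (insert i' {j} \<in> {{}, {i}} \<or> (\<exists>m\<in>{j}. m \<notin> H (insert i' {j}))))"
      by blast
  qed (use \<pi>(1) H in \<open>auto simp: card_insert_if\<close>)
qed

lemma attracted_if_two_cycle:
  assumes "f (f s) = s"
  shows "attracted_up_to_iso f"
proof (cases "surj f")
  case True
  then have "inj f" by (simp add: finite_UNIV_surj_inj)
  then show ?thesis
    using attracted_if_two_cycle_bij[OF _ assms] attracted_if_involution by blast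
next
  case False
  then show ?thesis using attracted_if_two_cycle_not_surj[OF assms] by blast
qed

section \<open>Non-surjective networks without a 2-cycle\<close>

text \<open>\<open>v\<close> becomes the centre of a path with ends \<open>u\<^sub>1\<close> and
  \<open>u\<^sub>2\<close>. Together with \<open>v\<^sub>1\<close> these points take all subsets of
  \<open>{i, j}\<close>, so other points mapped to them need no care. What remains is the arc from
  \<open>v\<^sub>1\<close> to \<open>w\<close> and a place for the full label.\<close>

context
  fixes v u\<^sub>1 u\<^sub>2 v\<^sub>1 w
  assumes no2: "\<And>x. f (f x) \<noteq> x"
    and f: "f u\<^sub>1 = v" "f u\<^sub>2 = v" "f v = v\<^sub>1" "f v\<^sub>1 = w"
    and u12: "u\<^sub>1 \<noteq> u\<^sub>2" and wu2: "w \<noteq> u\<^sub>2"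
begin

lemma vertex_neq: "u\<^sub>1 \<noteq> u\<^sub>2" "u\<^sub>1 \<noteq> v" "u\<^sub>2 \<noteq> v" "v \<noteq> v\<^sub>1" "u\<^sub>1 \<noteq> v\<^sub>1" "u\<^sub>2 \<noteq> v\<^sub>1" "w \<noteq> v\<^sub>1" "w \<noteq> v" "w \<noteq> u\<^sub>2"
  using u12 wu2 f nofix no2 by metis+

text \<open>
  \<open>v\<^sub>1\<close>, labelled \<open>{b}\<close>, has a decreasing arc if \<open>b\<close> is not in the label of \<open>w\<close>, and an arc to
  \<open>u\<^sub>2\<close> if both \<open>a\<close> and \<open>b\<close> are. As \<open>a\<close> and \<open>b\<close> can be interchanged after the other labels
  have been chosen, one of these cases can be assumed.
\<close>

lemma attracted_if_free_nonimage:
  assumes q: "q \<notin> range f" "q \<noteq> u\<^sub>2" and u1: "u\<^sub>1 \<in> range f"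
  shows "attracted_up_to_iso f"
proof -
  let ?ps = "\<lambda>a b. [(u\<^sub>1, {}), (u\<^sub>2, {i, j}), (v, {a}), (v\<^sub>1, {b}), (q, UNIV)]"
  have fq: "f x \<noteq> q" for x using q by auto
  have d: "q \<noteq> u\<^sub>1" "q \<noteq> u\<^sub>2" "q \<noteq> v" "q \<noteq> v\<^sub>1" "q \<noteq> w" using q u1 f by auto
  obtain \<rho> where \<rho>: "bij_betw \<rho> (- fst ` set (?ps i j)) (- snd ` set (?ps i j))"
    and \<rho>dec: "\<And>x. x \<notin> fst ` set (?ps i j) \<Longrightarrow> f x \<notin> fst ` set (?ps i j) \<Longrightarrow> \<not> \<rho> x \<subseteq> \<rho> (f x)"
  proof (rule label_outside_assignment[of f "?ps i j" p i k])
  qed (use vertex_neq d label_neq nofix in auto)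
  obtain a b where ab: "a = i \<and> b = j \<or> a = j \<and> b = i" and w: "b \<in> \<rho> w \<longrightarrow> a \<in> \<rho> w"
    by blast
  then have ab': "a \<noteq> b" "{i, j} = {a, b}" using ijkp by auto
  \<comment> \<open>Both choices use the same set of prescribed labels, so the same
    \<open>\<rho>\<close> fits.\<close>
  have same: "snd ` set (?ps i j) = snd ` set (?ps a b)" using ab by auto
  obtain \<pi> where \<pi>: "bij \<pi>" "\<And>x S. (x, S) \<in> set (?ps a b) \<Longrightarrow> \<pi> x = S"
    and out: "\<And>x. x \<notin> fst ` set (?ps a b) \<Longrightarrow> \<pi> x = \<rho> x"
    and dec: "\<And>x. x \<notin> fst ` set (?ps a b) \<Longrightarrow> \<not> \<pi> x \<subseteq> \<pi> (f x)"
  proof (rule glue_labelling[of "?ps a b" \<rho> f])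
    show "bij_betw \<rho> (- fst ` set (?ps a b)) (- snd ` set (?ps a b))"
      using \<rho> unfolding same by simp
    show "\<not> \<rho> x \<subseteq> \<rho> (f x)" if "x \<notin> fst ` set (?ps a b)" "f x \<notin> fst ` set (?ps a b)" for x
      using \<rho>dec that by simp
    show "T \<in> snd ` set (?ps a b)"
      if "(f x, S) \<in> set (?ps a b)" "x \<notin> fst ` set (?ps a b)" "T \<subseteq> S" for x S T
      using that fq[of x] ab by (auto simp: subset_singleton_iff subset_doubleton)
    show "distinct (map snd (?ps a b))" using ab
    proof (elim disjE conjE)
      assume "a = i" "b = j"
      then show ?thesis using label_neq by auto
    next
      assume "a = j" "b = i"
      then show ?thesis using label_neq by auto
    qed
  qed (use vertex_neq d in auto)
  have lab: "\<pi> u\<^sub>1 = {}" "\<pi> u\<^sub>2 = {a, b}" "\<pi> v = {a}" "\<pi> v\<^sub>1 = {b}" "\<pi> q = UNIV"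
    using \<pi>(2) ab'(2) by auto
  \<comment> \<open>\<open>w\<close> may be \<open>u\<^sub>1\<close>, where \<open>\<pi>\<close> is
    not \<open>\<rho>\<close> but the empty label; then the implication is trivial.\<close>
  have \<pi>w: "b \<in> \<pi> w \<longrightarrow> a \<in> \<pi> w"
    using w out[of w] lab(1) vertex_neq d by (cases "w = u\<^sub>1") auto
  define H where "H S = \<pi> (f (inv \<pi> S))" for S
  have H: "H (\<pi> x) = \<pi> (f x)" for x using \<pi>(1) by (simp add: H_def bij_is_inj)
  have Hb: "H {b} = \<pi> w" using H[of v\<^sub>1] f lab by simp
  show ?thesis
  proof (rule attracted_if_labelling[of \<pi> H f "{{}, {a}, {a, b}}" "if b \<in> \<pi> w then {b} else {}"])
    show "minimal_trap H {{}, {a}, {a, b}}"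
      using H[of u\<^sub>1] H[of u\<^sub>2] H[of v] f lab ab' by (intro minimal_trap_path3) auto
    show "\<not> \<pi> x \<subseteq> \<pi> (f x)"
      if "\<pi> x \<notin> {{}, {a}, {a, b}}" "\<pi> x \<noteq> (if b \<in> \<pi> w then {b} else {})" for x
    proof (cases "x \<in> {u\<^sub>1, u\<^sub>2, v, v\<^sub>1, q}")
      case True
      then have "x = q \<or> x = v\<^sub>1 \<and> b \<notin> \<pi> w" using that lab by (auto split: if_splits)
      then show ?thesis using lab f not_UNIV_subset[OF \<pi>(1) lab(5)] by auto
    qed (use dec[of x] in auto)
    show "(if b \<in> \<pi> w then {b} else {}) \<in> {{}, {a}, {a, b}} \<or>
      (\<exists>i'. i' \<notin> (if b \<in> \<pi> w then {b} else {}) \<and> i' \<in> H (if b \<in> \<pi> w then {b} else {}) \<and>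
        (insert i' (if b \<in> \<pi> w then {b} else {}) \<in> {{}, {a}, {a, b}} \<or>
         (\<exists>m\<in>(if b \<in> \<pi> w then {b} else {}). m \<notin> H (insert i' (if b \<in> \<pi> w then {b} else {})))))"
    proof (cases "b \<in> \<pi> w")
      case True
      then have "a \<notin> {b} \<and> a \<in> H {b} \<and> insert a {b} \<in> {{}, {a}, {a, b}}"
        using \<pi>w Hb ab' by auto
      then show ?thesis using True by auto
    qed auto
  qed (use \<pi>(1) H in \<open>auto simp: card_insert_if\<close>)
qed

text \<open>The only preimage of \<open>w\<close> is \<open>v\<^sub>1\<close>, so \<open>w\<close>
  can take the full label. Then \<open>v\<^sub>1\<close> with label \<open>{j}\<close> is
  \<open>E\<close>, and adding \<open>i\<close> enters the attractor at
  \<open>{i, j}\<close>.\<close>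

lemma attracted_if_unique_nonimage_far:
  assumes inj: "inj_on f (- {u\<^sub>2})" and w: "w \<noteq> u\<^sub>1"
  shows "attracted_up_to_iso f"
proof -
  let ?ps = "[(u\<^sub>1, {}), (u\<^sub>2, {i, j}), (v, {i}), (v\<^sub>1, {j}), (w, UNIV)]"
  have pre: "x = v\<^sub>1" if "f x = w" for x
    using that inj f vertex_neq by (metis ComplI inj_onD singletonD)
  obtain \<pi> where \<pi>: "bij \<pi>" "\<And>x S. (x, S) \<in> set ?ps \<Longrightarrow> \<pi> x = S"
    and dec: "\<And>x. x \<notin> fst ` set ?ps \<Longrightarrow> \<not> \<pi> x \<subseteq> \<pi> (f x)"
  proof (rule extend_assignment[of f ?ps p i k])
    show "T \<in> snd ` set ?ps" if "(f x, S) \<in> set ?ps" "x \<notin> fst ` set ?ps" "T \<subseteq> S" for x S T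
      using that pre[of x] by (auto simp: subset_singleton_iff subset_doubleton)
    show "distinct (map fst ?ps)" using vertex_neq w by simp
    show "distinct (map snd ?ps)" using label_neq by simp
    show "\<forall>(x, S)\<in>set ?ps. p \<in> S \<longrightarrow> CARD('n) \<le> Suc (card S)"
      using ijkp card_cosingleton by simp
    show "\<forall>(x, S)\<in>set ?ps. i \<in> S \<longrightarrow> k \<in> S \<longrightarrow> p \<in> S" using ijkp by simp
  qed (use ijkp nofix in simp_all)
  have lab: "\<pi> u\<^sub>1 = {}" "\<pi> u\<^sub>2 = {i, j}" "\<pi> v = {i}" "\<pi> v\<^sub>1 = {j}" "\<pi> w = UNIV"
    using \<pi>(2) by auto
  define H where "H S = \<pi> (f (inv \<pi> S))" for S
  have H: "H (\<pi> x) = \<pi> (f x)" for x using \<pi>(1) by (simp add: H_def bij_is_inj)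
  show ?thesis
  proof (rule attracted_if_labelling[of \<pi> H f "{{}, {i}, {i, j}}" "{j}"])
    show "minimal_trap H {{}, {i}, {i, j}}"
      using H[of u\<^sub>1] H[of u\<^sub>2] H[of v] f lab ijkp by (intro minimal_trap_path3) auto
    show "\<not> \<pi> x \<subseteq> \<pi> (f x)" if "\<pi> x \<notin> {{}, {i}, {i, j}}" "\<pi> x \<noteq> {j}" for x
      using dec[of x] that lab not_UNIV_subset[OF \<pi>(1) lab(5)]
      by (cases "x \<in> {u\<^sub>1, u\<^sub>2, v, v\<^sub>1, w}") auto
    have "i \<notin> {j} \<and> i \<in> H {j} \<and> insert i {j} \<in> {{}, {i}, {i, j}}"
      using H[of v\<^sub>1] f lab ijkp by auto
    then show "{j} \<in> {{}, {i}, {i, j}} \<or> (\<exists>i'. i' \<notin> {j} \<and> i' \<in> H {j} \<and>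
        (insert i' {j} \<in> {{}, {i}, {i, j}} \<or> (\<exists>m\<in>{j}. m \<notin> H (insert i' {j}))))"
      by blast
  qed (use \<pi>(1) H in \<open>auto simp: card_insert_if\<close>)
qed

text \<open>Now \<open>u\<^sub>1\<close>, \<open>v\<close>, \<open>v\<^sub>1\<close> form a 3-cycle
  with \<open>u\<^sub>2\<close> attached, and \<open>{j}\<close> is not below the empty label of its
  image. The full label must go elsewhere: \<open>f\<close> is injective on the other points and
  stays among them, so \<open>z\<close>, \<open>y\<close>, \<open>q\<close> are labelled as in
  \<open>attracted_if_two_cycle_bij\<close>, with \<open>k\<close> for \<open>j\<close>.\<close>

lemma attracted_if_unique_nonimage_near:
  assumes inj: "inj_on f (- {u\<^sub>2})" and u2: "u\<^sub>2 \<notin> range f" and w: "w = u\<^sub>1"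
    and z: "z \<notin> {u\<^sub>1, u\<^sub>2, v, v\<^sub>1}"
  shows "attracted_up_to_iso f"
proof -
  define y where "y = f z"
  define q where "q = f y"
  let ?ps = "[(u\<^sub>1, {}), (u\<^sub>2, {i, j}), (v, {i}), (v\<^sub>1, {j}), (z, {k}), (y, - {k}), (q, UNIV)]"
  have f': "f z = y" "f y = q" unfolding y_def q_def by auto
  have inj': "a = b" if "f a = f b" "a \<noteq> u\<^sub>2" "b \<noteq> u\<^sub>2" for a b
    using inj that by (auto dest: inj_onD)
  have u2': "f x \<noteq> u\<^sub>2" for x using u2 by auto
  have z: "z \<noteq> u\<^sub>1" "z \<noteq> u\<^sub>2" "z \<noteq> v" "z \<noteq> v\<^sub>1" using z by auto
  have step: "f x \<noteq> u\<^sub>1 \<and> f x \<noteq> v \<and> f x \<noteq> v\<^sub>1 \<and> f x \<noteq> u\<^sub>2"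
    if "x \<noteq> u\<^sub>1" "x \<noteq> u\<^sub>2" "x \<noteq> v" "x \<noteq> v\<^sub>1" for x
    using that inj' f w vertex_neq u2' by metis
  have y: "y \<noteq> u\<^sub>1" "y \<noteq> u\<^sub>2" "y \<noteq> v" "y \<noteq> v\<^sub>1" using step[of z] z f' by auto
  have q: "q \<noteq> u\<^sub>1" "q \<noteq> u\<^sub>2" "q \<noteq> v" "q \<noteq> v\<^sub>1" using step[of y] y f' by auto
  have d: "z \<noteq> y" "y \<noteq> q" "z \<noteq> q" using f' nofix no2 by metis+
  have pre: "f x = y \<longleftrightarrow> x = z" "f x = q \<longleftrightarrow> x = y" for x
    using inj' f' f z y q by metis+
  obtain \<pi> where \<pi>: "bij \<pi>" "\<And>x S. (x, S) \<in> set ?ps \<Longrightarrow> \<pi> x = S"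
    and dec: "\<And>x. x \<notin> fst ` set ?ps \<Longrightarrow> \<not> \<pi> x \<subseteq> \<pi> (f x)"
  proof (rule extend_assignment[of f ?ps p i k])
    show "T \<in> snd ` set ?ps" if fx: "(f x, S) \<in> set ?ps" "x \<notin> fst ` set ?ps" and "T \<subseteq> S" for x S T
    proof -
      have "f x \<noteq> y" "f x \<noteq> q" using fx(2) pre[of x] by auto
      then have "S \<in> {{}, {i, j}, {i}, {j}, {k}}" using fx(1) by auto
      then show ?thesis using \<open>T \<subseteq> S\<close> by (auto simp: subset_singleton_iff subset_doubleton)
    qed
    show "distinct (map fst ?ps)" using vertex_neq z y q d by simp
    show "distinct (map snd ?ps)" using label_neq by simp
    show "\<forall>(x, S)\<in>set ?ps. p \<in> S \<longrightarrow> CARD('n) \<le> Suc (card S)"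
      using ijkp card_cosingleton by simp
    show "\<forall>(x, S)\<in>set ?ps. i \<in> S \<longrightarrow> k \<in> S \<longrightarrow> p \<in> S" using ijkp by simp
  qed (use ijkp nofix in simp_all)
  have lab: "\<pi> u\<^sub>1 = {}" "\<pi> u\<^sub>2 = {i, j}" "\<pi> v = {i}" "\<pi> v\<^sub>1 = {j}" "\<pi> z = {k}" "\<pi> y = - {k}"
    "\<pi> q = UNIV" using \<pi>(2) by auto
  define H where "H S = \<pi> (f (inv \<pi> S))" for S
  have H: "H (\<pi> x) = \<pi> (f x)" for x using \<pi>(1) by (simp add: H_def bij_is_inj)
  let ?A = "{{}, {i}, {i, j}}"
  show ?thesis
  proof (rule attracted_if_labelling[of \<pi> H f ?A "- {k}"])
    show "minimal_trap H ?A"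
      using H[of u\<^sub>1] H[of u\<^sub>2] H[of v] f lab ijkp by (intro minimal_trap_path3) auto
    show "\<not> \<pi> x \<subseteq> \<pi> (f x)" if "\<pi> x \<notin> ?A" "\<pi> x \<noteq> - {k}" for x
      using dec[of x] that lab f f' w not_UNIV_subset[OF \<pi>(1) lab(7)]
      by (cases "x \<in> {u\<^sub>1, u\<^sub>2, v, v\<^sub>1, z, y, q}") auto
    have "f q \<noteq> y" "f q \<noteq> q" using pre d nofix by auto
    then have "\<exists>m\<in>- {k}. m \<notin> H (insert k (- {k}))"
      using coatom_not_subset[OF \<pi>(1) lab(6,7)] H[of q] lab by (simp add: Compl_insert)
    then show "- {k} \<in> ?A \<or> (\<exists>i'. i' \<notin> - {k} \<and> i' \<in> H (- {k}) \<and>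
        (insert i' (- {k}) \<in> ?A \<or> (\<exists>m\<in>- {k}. m \<notin> H (insert i' (- {k})))))"
      using H[of y] f' lab by auto
  qed (use \<pi>(1) H in \<open>auto simp: card_insert_if\<close>)
qed

end

lemma attracted_if_not_surj:
  assumes no2: "\<And>x. f (f x) \<noteq> x" and "\<not> surj f"
  shows "attracted_up_to_iso f"
proof -
  obtain v u\<^sub>1 u\<^sub>2 where u: "f u\<^sub>1 = v" "f u\<^sub>2 = v" and per: "\<exists>l>0. (f ^^ l) u\<^sub>1 = u\<^sub>1"
    and nper: "\<not> (\<exists>l>0. (f ^^ l) u\<^sub>2 = u\<^sub>2)"
    using periodic_point_with_nonperiodic_preimage[OF assms(2)] by metis
  obtain l where l: "l > 0" "(f ^^ l) u\<^sub>1 = u\<^sub>1" using per by blast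
  have u12: "u\<^sub>1 \<noteq> u\<^sub>2" using per nper by metis
  have "f (f v) = (f ^^ 3) u\<^sub>1" using u by (simp add: numeral_3_eq_3)
  \<comment> \<open>An iterate of the periodic point \<open>u\<^sub>1\<close> is periodic.\<close>
  then have wu2: "f (f v) \<noteq> u\<^sub>2" using periodic_funpow[OF l(2), of 3] l(1) nper by metis
  have "u\<^sub>1 = f ((f ^^ (l - 1)) u\<^sub>1)" using l by (metis Suc_diff_1 comp_apply funpow.simps(2))
  then have u1: "u\<^sub>1 \<in> range f" by (metis rangeI)
  note ctx = no2 u(1,2) refl refl u12 wu2
  show ?thesis
  proof (cases "\<exists>q. q \<notin> range f \<and> q \<noteq> u\<^sub>2")
    case True
    then show ?thesis using attracted_if_free_nonimage[OF ctx] u1 by blast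
  next
    case False
    then have u2: "u\<^sub>2 \<notin> range f" using assms(2) by auto
    \<comment> \<open>An image of \<open>u\<^sub>2\<close> is also an image of
      \<open>u\<^sub>1\<close>, so every point other than \<open>u\<^sub>2\<close> keeps a preimage
      when \<open>u\<^sub>2\<close> is removed; injectivity follows by counting.\<close>
    have "- {u\<^sub>2} \<subseteq> f ` (- {u\<^sub>2})"
    proof
      fix x assume "x \<in> - {u\<^sub>2}"
      then obtain y where y: "x = f y" using False by blast
      show "x \<in> f ` (- {u\<^sub>2})"
        using y u u12 by (cases "y = u\<^sub>2") auto
    qed
    then have inj: "inj_on f (- {u\<^sub>2})" by (intro finite_surj_inj) auto
    obtain z where "z \<notin> {u\<^sub>1, u\<^sub>2, v, f v}"
      using ex_not_in_list[of "[u\<^sub>1, u\<^sub>2, v, f v]"] by auto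
    then show ?thesis
      using attracted_if_unique_nonimage_far[OF ctx inj]
        attracted_if_unique_nonimage_near[OF ctx inj u2] by blast
  qed
qed

section \<open>Permutations without a 2-cycle\<close>

text \<open>The attractor consists of \<open>a\<close>, \<open>b\<close>, \<open>c\<close>,
  \<open>d\<close>, and \<open>c'\<close> with label \<open>{k}\<close> is \<open>E\<close>: its
  image is full, so adding \<open>j\<close> reaches \<open>{j, k}\<close>. The attractor forces
  \<open>{i, j}\<close> on \<open>b'\<close>, which must not be below the label of \<open>w\<close>.
  This holds if \<open>w\<close> is \<open>a\<close> or \<open>d\<close>; any other \<open>w\<close>
  gets \<open>- {i}\<close>, which is safe because \<open>b'\<close> is its only preimage.\<close>

lemma attracted_if_disjoint_paths:
  assumes inj: "inj f"
    and f: "f a = b" "f b = b'" "f b' = w" "f d = c" "f c = c'" "f c' = q"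
    and dist: "distinct [a, b, b', d, c, c', q]"
  shows "attracted_up_to_iso f"
proof -
  let ?ps = "[(a, {i}), (b, {}), (b', {i, j}), (c, {j}), (d, {j, k}), (c', {k}), (q, UNIV)]
    @ (if w = a \<or> w = d then [] else [(w, - {i})])"
  have inj': "f x = f y \<longleftrightarrow> x = y" for x y using inj by (auto dest: injD)
  have pre: "f x = b \<longleftrightarrow> x = a" "f x = b' \<longleftrightarrow> x = b" "f x = w \<longleftrightarrow> x = b'" "f x = c \<longleftrightarrow> x = d"
    "f x = c' \<longleftrightarrow> x = c" "f x = q \<longleftrightarrow> x = c'" for x
    using f inj' by metis+
  have ne: "a \<noteq> b" "a \<noteq> b'" "a \<noteq> d" "a \<noteq> c" "a \<noteq> c'" "a \<noteq> q" "b \<noteq> b'" "b \<noteq> d" "b \<noteq> c" "b \<noteq> c'"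
    "b \<noteq> q" "b' \<noteq> d" "b' \<noteq> c" "b' \<noteq> c'" "b' \<noteq> q" "d \<noteq> c" "d \<noteq> c'" "d \<noteq> q" "c \<noteq> c'" "c \<noteq> q" "c' \<noteq> q"
    using dist by auto
  have w: "w \<noteq> b" "w \<noteq> b'" "w \<noteq> c" "w \<noteq> c'" "w \<noteq> q"
    using f(3) pre[of b'] ne nofix[of b'] by auto
  obtain \<pi> where \<pi>: "bij \<pi>" "\<And>x S. (x, S) \<in> set ?ps \<Longrightarrow> \<pi> x = S"
    and dec: "\<And>x. x \<notin> fst ` set ?ps \<Longrightarrow> \<not> \<pi> x \<subseteq> \<pi> (f x)"
  proof (rule extend_assignment[of f ?ps p i k])
    show "T \<in> snd ` set ?ps" if fx: "(f x, S) \<in> set ?ps" "x \<notin> fst ` set ?ps" and "T \<subseteq> S" for x S T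
    proof -
      have x: "x \<noteq> a" "x \<noteq> b" "x \<noteq> b'" "x \<noteq> c" "x \<noteq> d" "x \<noteq> c'" using fx(2) by auto
      have "f x \<noteq> b" "f x \<noteq> b'" "f x \<noteq> w" "f x \<noteq> c" "f x \<noteq> c'" "f x \<noteq> q"
        using x pre[of x] by simp_all
      \<comment> \<open>Only \<open>a\<close> and \<open>d\<close> can have a preimage without
        prescribed label, and all subsets of their labels are prescribed.\<close>
      then have "S = {i} \<or> S = {j, k}" using fx(1) by (simp split: if_splits) blast+
      then have "T \<in> {{}, {i}, {j}, {k}, {j, k}}"
        using \<open>T \<subseteq> S\<close> by (auto simp: subset_singleton_iff subset_doubleton)
      then show ?thesis by (simp split: if_splits) blast+
    qed
    show "distinct (map fst ?ps)" using ne w by (simp, blast)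
    have "{i, j} \<noteq> {j, k}" "UNIV \<noteq> - {i}" using ijkp by (auto simp: doubleton_eq_iff)
    then show "distinct (map snd ?ps)" using label_neq by simp
    show "\<forall>(x, S)\<in>set ?ps. p \<in> S \<longrightarrow> CARD('n) \<le> Suc (card S)"
      using ijkp card_cosingleton by simp
    show "\<forall>(x, S)\<in>set ?ps. i \<in> S \<longrightarrow> k \<in> S \<longrightarrow> p \<in> S" using ijkp by simp
  qed (use ijkp nofix in simp_all)
  have lab: "\<pi> a = {i}" "\<pi> b = {}" "\<pi> b' = {i, j}" "\<pi> c = {j}" "\<pi> d = {j, k}" "\<pi> c' = {k}"
    "\<pi> q = UNIV" using \<pi>(2) by auto
  have \<pi>w: "\<pi> w = - {i}" if "w \<noteq> a" "w \<noteq> d" using \<pi>(2)[of w "- {i}"] that by auto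
  have dec_b': "\<not> \<pi> b' \<subseteq> \<pi> (f b')"
    using lab \<pi>w f(3) ijkp by (cases "w = a \<or> w = d") auto
  have dec_w: "\<not> \<pi> w \<subseteq> \<pi> (f w)" if wn: "w \<noteq> a" "w \<noteq> d"
  proof -
    have "f w \<noteq> w" "f w \<noteq> q" using nofix pre w by auto
    then show ?thesis using coatom_not_subset[OF \<pi>(1) \<pi>w[OF wn] lab(7)] \<pi>w[OF wn] by blast
  qed
  define H where "H S = \<pi> (f (inv \<pi> S))" for S
  have H: "H (\<pi> x) = \<pi> (f x)" for x using \<pi>(1) by (simp add: H_def bij_is_inj)
  let ?A = "{{i}, {}, {j}, {j, k}}"
  show ?thesis
  proof (rule attracted_if_labelling[of \<pi> H f ?A "{k}"])
    show "minimal_trap H ?A"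
      using H[of a] H[of b] H[of c] H[of d] f lab ijkp by (intro minimal_trap_path4) auto
    show "\<not> \<pi> x \<subseteq> \<pi> (f x)" if "\<pi> x \<notin> ?A" "\<pi> x \<noteq> {k}" for x
    proof -
      have "x \<noteq> a" "x \<noteq> b" "x \<noteq> c" "x \<noteq> d" "x \<noteq> c'" using that lab by auto
      then consider "x = b'" | "x = q" | "x = w" "w \<noteq> a" "w \<noteq> d" | "x \<notin> fst ` set ?ps"
        by (cases "w = a \<or> w = d") auto
      then show ?thesis
        using dec_b' dec_w dec[of x] not_UNIV_subset[OF \<pi>(1) lab(7)] lab(7) by cases auto
    qed
    have "j \<notin> {k} \<and> j \<in> H {k} \<and> insert j {k} \<in> ?A"
      using H[of c'] f lab ijkp by auto
    then show "{k} \<in> ?A \<or> (\<exists>i'. i' \<notin> {k} \<and> i' \<in> H {k} \<and>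
        (insert i' {k} \<in> ?A \<or> (\<exists>m\<in>{k}. m \<notin> H (insert i' {k}))))"
      by blast
    show "card ?A \<le> 4" by (simp add: card_insert_if)
  qed (use \<pi>(1) H in auto)
qed

lemma not_all_in_three_cycles: "\<exists>x. f (f (f x)) \<noteq> x"
proof (rule ccontr)
  assume "\<not> ?thesis"
  then have f3: "f (f (f x)) = x" for x by simp
  let ?C = "range (\<lambda>x. {x, f x, f (f x)})"
  \<comment> \<open>Without fixed points every orbit has exactly three elements, so the orbits cut
    the cube into triples.\<close>
  have "3 * card ?C = card (\<Union> ?C)"
  proof (rule card_partition)
    show "card c = 3" if "c \<in> ?C" for c
    proof -
      obtain x where c: "c = {x, f x, f (f x)}" using \<open>c \<in> ?C\<close> by auto
      have "x \<noteq> f (f x)" using f3[of x] nofix by metis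
      moreover have "f x \<noteq> x" "f (f x) \<noteq> f x" using nofix by auto
      ultimately show ?thesis unfolding c by (auto simp: card_insert_if)
    qed
    show "c \<inter> c' = {}" if cc: "c \<in> ?C" "c' \<in> ?C" "c \<noteq> c'" for c c'
    proof (rule ccontr)
      obtain x y where xy: "c = {x, f x, f (f x)}" "c' = {y, f y, f (f y)}" using cc by auto
      have orb: "{z, f z, f (f z)} = {x, f x, f (f x)}" if "z \<in> {x, f x, f (f x)}" for x z
        using that f3 by auto
      assume "c \<inter> c' \<noteq> {}"
      then obtain z where "z \<in> c" "z \<in> c'" by blast
      then show False using orb[of z x] orb[of z y] xy cc(3) by simp
    qed
  qed auto
  moreover have "\<Union> ?C = UNIV" by auto
  ultimately have "CARD('n conf) = 3 * card ?C" by (simp only:)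
  then have "3 dvd CARD('n conf)" by (rule dvdI)
  then have "3 dvd (2 :: nat) ^ CARD('n)" by (simp add: card_fun)
  moreover have "\<not> 3 dvd (2 :: nat) ^ m" for m
  proof (induction m)
    case (Suc m)
    have "3 dvd 2 * n \<Longrightarrow> 3 dvd n" for n :: nat by presburger
    from this[of "2 ^ m"] show ?case using Suc unfolding power_Suc by blast
  qed simp
  ultimately show False by blast
qed

text \<open>The cycle of \<open>d\<close> has length at least 4 and contains the stretch of four
  points; a second cycle, of length at least 3, gives the other stretch. A single cycle has at least
  16 points, and both stretches are cut from it in succession.\<close>

lemma attracted_if_bij:
  assumes no2: "\<And>x. f (f x) \<noteq> x" and inj: "inj f"
  shows "attracted_up_to_iso f"
proof -
  have inj': "f x = f y \<longleftrightarrow> x = y" for x y using inj by (auto dest: injD)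
  obtain d where d: "f (f (f d)) \<noteq> d" using not_all_in_three_cycles by blast
  obtain l where l: "l > 0" "(f ^^ l) d = d" "inj_on (\<lambda>m. (f ^^ m) d) {..<l}"
    using funpow_period[of UNIV f d] inj by auto
  define Orb where "Orb = range (\<lambda>m. (f ^^ m) d)"
  have fOrb: "f x \<in> Orb \<longleftrightarrow> x \<in> Orb" for x
  proof
    assume "x \<in> Orb"
    then obtain m where "x = (f ^^ m) d" unfolding Orb_def by auto
    then have "f x = (f ^^ Suc m) d" by simp
    then show "f x \<in> Orb" unfolding Orb_def by blast
  next
    assume "f x \<in> Orb"
    then obtain m where m: "f x = (f ^^ m) d" unfolding Orb_def by auto
    have "f x = f ((f ^^ (l - 1 + m)) d)"
    proof -
      have "f ((f ^^ (l - 1 + m)) d) = (f ^^ (m + l)) d"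
        using l(1) by (metis Suc_diff_1 add.commute add_Suc comp_apply funpow.simps(2))
      also have "\<dots> = (f ^^ m) d" using l(2) by (simp add: funpow_add)
      finally show ?thesis using m by simp
    qed
    then have "x = (f ^^ (l - 1 + m)) d" using inj' by blast
    then show "x \<in> Orb" unfolding Orb_def by blast
  qed
  show ?thesis
  proof (cases "\<exists>a. a \<notin> Orb")
    case True
    then obtain a where a: "a \<notin> Orb" by blast
    have "d = (f ^^ 0) d" by simp
    then have "d \<in> Orb" unfolding Orb_def by blast
    then have Orb: "d \<in> Orb" "f d \<in> Orb" "f (f d) \<in> Orb" "f (f (f d)) \<in> Orb" by (simp_all add: fOrb)
    have nOrb: "a \<notin> Orb" "f a \<notin> Orb" "f (f a) \<notin> Orb" using a by (simp_all add: fOrb)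
    have "{a, f a, f (f a)} \<subseteq> - Orb" "{d, f d, f (f d), f (f (f d))} \<subseteq> Orb"
      using Orb nOrb by simp_all
    then have "{a, f a, f (f a)} \<inter> {d, f d, f (f d), f (f (f d))} = {}" by blast
    moreover have "distinct [a, f a, f (f a)]"
      using nofix[of a] nofix[of "f a"] no2[of a] by (simp add: eq_commute)
    moreover have "distinct [d, f d, f (f d), f (f (f d))]"
      using nofix[of d] nofix[of "f d"] nofix[of "f (f d)"] no2[of d] no2[of "f d"] d
      by (simp add: eq_commute)
    ultimately have "distinct [a, f a, f (f a), d, f d, f (f d), f (f (f d))]"
      by (simp, blast)
    then show ?thesis using attracted_if_disjoint_paths[OF inj refl refl refl refl refl refl] by blast
  next
    case False
    have "Orb = (\<lambda>m. (f ^^ m) d) ` {..<l}"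
    proof -
      have "(f ^^ m) d = (f ^^ (m mod l)) d" for m
        using l(2) by (metis funpow_mod_eq)
      then show ?thesis unfolding Orb_def using l(1) by (auto intro!: image_eqI[of _ _ "_ mod l"])
    qed
    then have "card Orb = l" using l(3) by (simp add: card_image)
    moreover have "Orb = UNIV" using False by auto
    ultimately have "7 \<le> l" using card_conf_ge by simp
    then have "inj_on (\<lambda>m. (f ^^ m) d) (set [0..<7])" using l(3) by (rule_tac inj_on_subset) auto
    then have "distinct (map (\<lambda>m. (f ^^ m) d) [0..<7])" by (simp add: distinct_map)
    then have "distinct [d, f d, f (f d), f (f (f d)), f (f (f (f d))), f (f (f (f (f d)))),
        f (f (f (f (f (f d)))))]"
      by (simp add: upt_rec numeral_eq_Suc del: distinct.simps)
    then show ?thesis using attracted_if_disjoint_paths[OF inj refl refl refl refl refl refl] by blast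
  qed
qed

end

theorem theorem8:
  fixes f :: "'n::finite conf \<Rightarrow> 'n conf"
  assumes "CARD('n) \<ge> 5"
    and "\<forall>x. f x \<noteq> x"
  shows "\<exists>h :: 'n conf \<Rightarrow> 'n conf. h \<sim>\<^sub>S f \<and>
    (\<exists>A. attractor (async_graph h) A \<and> card A \<le> 4 \<and>
      (\<forall>x. \<exists>y\<in>A. \<exists>p. almost_decreasing_path (async_graph h) x p y))"
proof -
  obtain C :: "'n set" where C: "card C = 4"
    using obtain_subset_with_card_n[of 4 "UNIV :: 'n set"] assms(1) by auto
  obtain xs where xs: "set xs = C" "distinct xs" using finite_distinct_list[of C] by auto
  then have "length xs = 4" using C distinct_card by metis
  then obtain i j k p where "xs = [i, j, k, p]"
    by (auto simp: numeral_eq_Suc length_Suc_conv)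
  then interpret labels f i j k p
    using assms(2) xs(2) by unfold_locales auto
  have "attracted_up_to_iso f"
  proof (cases "\<exists>s. f (f s) = s")
    case True
    then show ?thesis using attracted_if_two_cycle by blast
  next
    case False
    then have no2: "f (f x) \<noteq> x" for x by blast
    show ?thesis
    proof (cases "surj f")
      case True
      then show ?thesis using attracted_if_bij[OF no2] by (simp add: finite_UNIV_surj_inj)
    next
      case False
      then show ?thesis by (rule attracted_if_not_surj[OF no2])
    qed
  qed
  then show ?thesis unfolding attracted_up_to_iso_def .
qed

end
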